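(* Let $B$ be an infinite Blaschke product with zeros $\{a_n\}$ that are uniformly discrete. If $B' \in A_{\alpha}^p$, where $\alpha > -1$ and $\alpha + 1 < p < \alpha + 2$, then \[ \sum_n (1-|a_n|)^{2-p+\alpha} < \infty. \]
   Context: $U$ denotes the open unit disc in $\mathbb{C}$. For $0<p<\infty$ and $\alpha>-1$, $A_\alpha^p$ is the set of all functions $f$ analytic in $U$ with $\|f\|_{A_\alpha^p} = \left\{\frac{1}{\pi}\iint_U |f(z)|^p (1-|z|)^\alpha\, dA(z)\right\}^{1/p} < \infty$, where $dA$ is Lebesgue area measure. If $\{a_n\}_{n\ge 1}$ is a sequence of complex numbers with $0<|a_n|<1$ for all $n$ and $\sum_n (1-|a_n|)<\infty$, the Blaschke product with zeros $\{a_n\}$ is the analytic function on $U$ given by $B(z) = \prod_{n=1}^\infty \frac{\bar a_n}{|a_n|}\frac{a_n - z}{1-\bar a_n z}$. A sequence $\{a_n\}$ in $U$ is uniformly discrete (also called separated) if there is a constant $\delta>0$ such that $\rho(a_m,a_n)\ge\delta$ for all $m\ne n$, where $\rho(z,w) = \left|\frac{z-w}{1-\bar w z}\right|$ is the pseudohyperbolic metric on $U$. *)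

theory Defs
  imports "HOL-Complex_Analysis.Complex_Analysis"
begin

(* Real powers on [0,\<infinity>], for exponents s > 0 only (so that \<infinity> is sent to \<infinity>). *)
definition ennreal_powr :: "ennreal \<Rightarrow> real \<Rightarrow> ennreal" where
  "ennreal_powr x s = (if x = \<infinity> then \<infinity> else ennreal (enn2real x powr s))"

definition bergman_norm :: "real \<Rightarrow> real \<Rightarrow> (complex \<Rightarrow> complex) \<Rightarrow> ennreal" where
  "bergman_norm p \<alpha> f =
     ennreal_powr
       (ennreal (1 / pi) *
         (\<integral>\<^sup>+ z \<in> ball 0 1. ennreal (norm (f z) powr p * (1 - norm z) powr \<alpha>) \<partial>lborel))
       (1 / p)"

definition bergman_space :: "real \<Rightarrow> real \<Rightarrow> (complex \<Rightarrow> complex) set" where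
  "bergman_space p \<alpha> = {f. f holomorphic_on ball 0 1 \<and> bergman_norm p \<alpha> f < \<infinity>}"

definition blaschke_sequence :: "(nat \<Rightarrow> complex) \<Rightarrow> bool" where
  "blaschke_sequence a \<longleftrightarrow>
     (\<forall>n. 0 < norm (a n) \<and> norm (a n) < 1) \<and> summable (\<lambda>n. 1 - norm (a n))"

(* Only the values on the unit disc are meaningful. *)
definition blaschke_product :: "(nat \<Rightarrow> complex) \<Rightarrow> complex \<Rightarrow> complex" where
  "blaschke_product a z =
     (\<Prod>n. cnj (a n) / of_real (norm (a n)) * ((a n - z) / (1 - cnj (a n) * z)))"

definition pseudohyperbolic_dist :: "complex \<Rightarrow> complex \<Rightarrow> real" where
  "pseudohyperbolic_dist z w = norm ((z - w) / (1 - cnj w * z))"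

definition uniformly_discrete :: "(nat \<Rightarrow> complex) \<Rightarrow> bool" where
  "uniformly_discrete a \<longleftrightarrow>
     (\<forall>n. a n \<in> ball 0 1) \<and>
     (\<exists>\<delta>>0. \<forall>m n. m \<noteq> n \<longrightarrow> pseudohyperbolic_dist (a m) (a n) \<ge> \<delta>)"

end

theory Submission imports Defs begin

text \<open>
  Put \<open>\<kappa> = p - 1 - \<alpha>\<close>; the hypotheses say \<open>0 < \<kappa> < 1\<close> and \<open>\<kappa> < p\<close>, and the claim is
  that the numbers \<open>(1 - |a\<^sub>n|)\<^bsup>1-\<kappa>\<^esup>\<close> have a finite sum.

  A zero \<open>a\<^sub>n\<close> forces \<open>B\<close> to be small not only at \<open>a\<^sub>n\<close> but on a whole box around it of
  side comparable to \<open>1 - |a\<^sub>n|\<close>, because \<open>|B(z)| \<le> \<rho>(z, a\<^sub>n)\<close>.  Near the unit circle, on the other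
  hand, \<open>|B|\<close> is close to 1 on average.  So along almost every ray that meets such a box \<open>|B|\<close> climbs from at
  most 1/2 to nearly 1, and the radial integral of \<open>|B'|\<close> from the box to the circle is bounded below.
  This replaces a lower bound for \<open>|B'|\<close> in the box itself, which can fail
  when the zeros do not form an interpolating sequence.

  A Hardy inequality along rays, \<open>radial_hardy_inequality\<close>, turns this into
  a bound for the integral of \<open>(1 - r)\<^bsup>-\<kappa>-1\<^esup>\<close> over the union of the boxes by the integral of
  \<open>|B'|\<^sup>p (1 - |z|)\<^bsup>\<alpha>\<^esup>\<close>.  Exponents \<open>p < 1\<close> cost nothing: since \<open>|B'(z)| \<le> 1 / (1 - |z|)\<close>,
  the power \<open>p + 1\<close> of \<open>|B'|\<close> with the weight \<open>(1 - |z|)\<^bsup>\<alpha>+1\<^esup>\<close> is dominated by the power \<open>p\<close> with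
  the given weight; this is built into \<open>young_split\<close>.  Finally, each box contributes
  a multiple of \<open>(1 - |a\<^sub>n|)\<^sup>2 (1 - |a\<^sub>n|)\<^bsup>-\<kappa>-1\<^esup>\<close>, and uniform discreteness makes
  the boxes disjoint.

  The boundary behaviour enters only through \<open>blaschke_defect_circle_mean_small\<close>: the means of
  \<open>1 - |B|\<close> over circles of radius \<open>R\<close> can be made small with \<open>R\<close> arbitrarily close to 1.  This
  avoids the almost-everywhere theory of radial limits, since every estimate can be
  made with rays cut off at such a radius \<open>R\<close>.  Area integrals and ray integrals are compared by
  \<open>nn_integral_polar_le\<close>.
\<close>

section \<open>Blaschke factors and products\<close>

definition blaschke_factor :: "complex \<Rightarrow> complex \<Rightarrow> complex" where
  "blaschke_factor w z = cnj w / of_real (norm w) * ((w - z) / (1 - cnj w * z))"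

lemma blaschke_denominator_bound:
  fixes w z :: complex
  assumes "norm w \<le> 1"
  shows "1 - norm z \<le> norm (1 - cnj w * z)"
proof -
  have "norm (cnj w * z) \<le> norm z"
    using assms by (simp add: norm_mult mult_left_le_one_le)
  moreover have "1 - norm (cnj w * z) \<le> norm (1 - cnj w * z)"
    using norm_triangle_ineq2[of 1 "cnj w * z"] by simp
  ultimately show ?thesis by linarith
qed

lemma blaschke_denominator_bound':
  fixes w z :: complex
  assumes "norm z \<le> 1"
  shows "1 - norm w \<le> norm (1 - cnj w * z)"
proof -
  have "norm (cnj w * z) \<le> norm w"
    using assms by (simp add: norm_mult mult_right_le_one_le)
  moreover have "1 - norm (cnj w * z) \<le> norm (1 - cnj w * z)"
    using norm_triangle_ineq2[of 1 "cnj w * z"] by simp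
  ultimately show ?thesis by linarith
qed

lemma norm_blaschke_factor:
  assumes "w \<noteq> 0"
  shows "norm (blaschke_factor w z) = norm (w - z) / norm (1 - cnj w * z)"
  using assms by (simp add: blaschke_factor_def norm_mult norm_divide)

lemma pseudohyperbolic_dist_eq_norm_blaschke_factor:
  assumes "w \<noteq> 0"
  shows "pseudohyperbolic_dist z w = norm (blaschke_factor w z)"
  by (simp only: norm_blaschke_factor[OF assms] pseudohyperbolic_dist_def norm_divide norm_minus_commute[of w z])

lemma moebius_norm_identity:
  fixes w z :: complex
  shows "(norm (1 - cnj w * z))\<^sup>2 - (norm (w - z))\<^sup>2 = (1 - (norm w)\<^sup>2) * (1 - (norm z)\<^sup>2)"
proof -
  have "complex_of_real ((norm (1 - cnj w * z))\<^sup>2 - (norm (w - z))\<^sup>2)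
      = complex_of_real ((1 - (norm w)\<^sup>2) * (1 - (norm z)\<^sup>2))"
    by (simp add: complex_norm_square del: of_real_power) (simp add: algebra_simps)
  then show ?thesis using of_real_eq_iff by blast
qed

lemma norm_blaschke_factor_le_1:
  assumes "0 < norm w" "norm w < 1" "norm z \<le> 1"
  shows "norm (blaschke_factor w z) \<le> 1"
proof -
  have "0 \<le> (1 - (norm w)\<^sup>2) * (1 - (norm z)\<^sup>2)"
    using assms by (intro mult_nonneg_nonneg) (auto simp: abs_square_le_1)
  then have "norm (w - z) \<le> norm (1 - cnj w * z)"
    using moebius_norm_identity[of w z] by - (rule power2_le_imp_le, linarith, simp)
  then show ?thesis
    using assms by (auto simp: norm_blaschke_factor divide_le_eq_1)
qed

lemma norm_blaschke_factor_sphere: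
  assumes "0 < norm w" "norm w < 1" "norm z = 1"
  shows "norm (blaschke_factor w z) = 1"
proof -
  have "(norm (1 - cnj w * z))\<^sup>2 = (norm (w - z))\<^sup>2"
    using moebius_norm_identity[of w z] assms by simp
  then have "norm (w - z) = norm (1 - cnj w * z)"
    by (metis norm_ge_zero power2_eq_imp_eq)
  moreover have "norm (1 - cnj w * z) > 0"
    using blaschke_denominator_bound'[of z w] assms by linarith
  ultimately show ?thesis
    using assms by (auto simp: norm_blaschke_factor)
qed

lemma blaschke_factor_0:
  assumes "w \<noteq> 0"
  shows "blaschke_factor w 0 = of_real (norm w)"
  using assms complex_norm_square[of w] by (simp add: blaschke_factor_def field_simps power2_eq_square)

lemma blaschke_denominator_nonzero:
  fixes w z :: complex
  assumes "norm w < 1" "norm z \<le> 1"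
  shows "1 - cnj w * z \<noteq> 0"
  using blaschke_denominator_bound'[of z w] assms by auto

lemma continuous_on_blaschke_factor:
  assumes "norm w < 1"
  shows "continuous_on (cball 0 1) (blaschke_factor w)"
  unfolding blaschke_factor_def
  by (intro continuous_intros) (use assms blaschke_denominator_nonzero in auto)

lemma holomorphic_blaschke_factor:
  assumes "norm w < 1"
  shows "blaschke_factor w holomorphic_on ball 0 1"
  unfolding blaschke_factor_def
  by (intro holomorphic_intros) (use assms blaschke_denominator_nonzero in auto)

text \<open>
  The unimodular constant in a Blaschke factor is chosen so that the factor is close to 1 away from
  the boundary: \<open>b(z) - 1\<close> is a multiple of \<open>1 - |w|\<close>.  This is what makes the
  product converge under the Blaschke condition.
\<close>

lemma norm_blaschke_factor_minus_1:
  assumes "0 < norm w" "norm w < 1" "norm z \<le> r" "r < 1"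
  shows "norm (blaschke_factor w z - 1) \<le> (1 - norm w) * (2 / (1 - r))"
proof -
  have nz: "1 - cnj w * z \<noteq> 0" "w \<noteq> 0"
    using blaschke_denominator_nonzero assms by auto
  have "blaschke_factor w z - 1 =
      (cnj w * (w - z) - of_real (norm w) * (1 - cnj w * z)) / (of_real (norm w) * (1 - cnj w * z))"
    using nz by (simp add: blaschke_factor_def field_simps)
  also have "cnj w * (w - z) - of_real (norm w) * (1 - cnj w * z)
      = - of_real (1 - norm w) * (of_real (norm w) + cnj w * z)"
    using complex_norm_square[of w] by (simp add: algebra_simps power2_eq_square)
  finally have "norm (blaschke_factor w z - 1)
      = (1 - norm w) * norm (of_real (norm w) + cnj w * z) / (norm w * norm (1 - cnj w * z))"
    using assms by (simp add: norm_divide norm_mult del: of_real_diff)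
  also have "\<dots> \<le> (1 - norm w) * (norm w * 2) / (norm w * (1 - r))"
  proof (intro frac_le mult_left_mono mult_nonneg_nonneg mult_pos_pos)
    have "norm (of_real (norm w) + cnj w * z) \<le> norm w + norm w * norm z"
      using norm_triangle_ineq[of "of_real (norm w)" "cnj w * z"] by (simp add: norm_mult)
    also have "\<dots> \<le> norm w * 2"
      using mult_left_mono[of "norm z" 1 "norm w"] assms by simp
    finally show "norm (of_real (norm w) + cnj w * z) \<le> norm w * 2" .
    show "1 - r \<le> norm (1 - cnj w * z)"
      using blaschke_denominator_bound[of w z] assms by linarith
  qed (use assms in auto)
  also have "\<dots> = (1 - norm w) * (2 / (1 - r))"
    using assms by (simp add: field_simps)
  finally show ?thesis .
qed

lemma blaschke_product_eq:
  "blaschke_product a z = (\<Prod>n. blaschke_factor (a n) z)"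
  by (simp add: blaschke_product_def blaschke_factor_def)

context
  fixes a :: "nat \<Rightarrow> complex"
  assumes bl: "blaschke_sequence a"
begin

lemma zero_norms: "0 < norm (a n)" "norm (a n) < 1" "a n \<noteq> 0"
  using bl by (auto simp: blaschke_sequence_def)

lemma uniform_limit_blaschke_partial_products:
  assumes "r < 1"
  shows "uniform_limit (cball 0 r) (\<lambda>N z. \<Prod>n<N. blaschke_factor (a n) z)
           (blaschke_product a) sequentially"
proof -
  let ?P = "\<lambda>N z. \<Prod>n<N. blaschke_factor (a n) z"
  have summ: "summable (\<lambda>n. (1 - norm (a n)) * (2 / (1 - r)))"
    using bl by (intro summable_mult2) (auto simp: blaschke_sequence_def)
  have bound: "norm (blaschke_factor (a n) z - 1) \<le> (1 - norm (a n)) * (2 / (1 - r))"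
    if "z \<in> cball 0 r" for n z
    using that assms zero_norms by (intro norm_blaschke_factor_minus_1) auto
  have "uniformly_convergent_on (cball 0 r) ?P"
  proof (rule uniformly_convergent_on_prod')
    show "continuous_on (cball 0 r) (blaschke_factor (a n))" for n
      by (rule continuous_on_subset[OF continuous_on_blaschke_factor]) (use assms zero_norms in auto)
    show "uniformly_convergent_on (cball 0 r) (\<lambda>N x. \<Sum>n<N. norm (blaschke_factor (a n) x - 1))"
      by (rule Weierstrass_m_test'[OF _ summ]) (use bound in auto)
  qed auto
  then obtain l where l: "uniform_limit (cball 0 r) ?P l sequentially"
    by (auto simp: uniformly_convergent_on_def)
  have "l z = blaschke_product a z" if z: "z \<in> cball 0 r" for z
  proof -
    have "abs_convergent_prod (\<lambda>n. blaschke_factor (a n) z)"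
      by (rule summable_imp_abs_convergent_prod, rule summable_comparison_test'[OF summ])
         (use bound z in auto)
    then have "convergent_prod (\<lambda>n. blaschke_factor (a n) z)"
      by (rule abs_convergent_prod_imp_convergent_prod)
    then have "(\<lambda>N. \<Prod>n\<le>N. blaschke_factor (a n) z) \<longlonglongrightarrow> blaschke_product a z"
      unfolding blaschke_product_eq by (rule convergent_prod_LIMSEQ)
    moreover have "(\<lambda>N. ?P (Suc N) z) \<longlonglongrightarrow> l z"
      by (rule LIMSEQ_Suc, rule tendsto_uniform_limitI[OF l z])
    ultimately show ?thesis
      using LIMSEQ_unique by (fastforce simp: lessThan_Suc_atMost)
  qed
  then show ?thesis
    using l uniform_limit_cong'[of "cball 0 r" ?P ?P l "blaschke_product a"] by auto
qed

lemma blaschke_partial_products_tendsto: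
  assumes "norm z < 1"
  shows "(\<lambda>N. \<Prod>n<N. blaschke_factor (a n) z) \<longlonglongrightarrow> blaschke_product a z"
  by (rule tendsto_uniform_limitI[OF uniform_limit_blaschke_partial_products[OF assms]]) auto

lemma holomorphic_blaschke_product: "blaschke_product a holomorphic_on ball 0 1"
proof (rule holomorphic_uniform_sequence)
  show "(\<lambda>z. \<Prod>n<N. blaschke_factor (a n) z) holomorphic_on ball 0 1" for N
    by (intro holomorphic_intros holomorphic_blaschke_factor zero_norms)
  fix z :: complex assume z: "z \<in> ball 0 1"
  define d where "d = (1 - norm z) / 2"
  have "cball z d \<subseteq> cball 0 (norm z + d)"
    by (simp add: cball_subset_cball_iff)
  then have "uniform_limit (cball z d) (\<lambda>N z. \<Prod>n<N. blaschke_factor (a n) z) (blaschke_product a) sequentially"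
    by (rule uniform_limit_on_subset[rotated])
       (rule uniform_limit_blaschke_partial_products, use z in \<open>simp add: d_def field_simps\<close>)
  moreover have "cball z d \<subseteq> ball 0 1" "d > 0"
    using z by (auto simp: d_def cball_subset_ball_iff field_simps)
  ultimately show "\<exists>d>0. cball z d \<subseteq> ball 0 1 \<and>
      uniform_limit (cball z d) (\<lambda>N z. \<Prod>n<N. blaschke_factor (a n) z) (blaschke_product a) sequentially"
    by blast
qed auto

text \<open>
  All other factors have modulus at most 1.
\<close>

lemma norm_blaschke_product_le_pseudohyperbolic:
  assumes z: "norm z < 1"
  shows "norm (blaschke_product a z) \<le> pseudohyperbolic_dist z (a n)"
proof (rule Lim_bounded)
  show "(\<lambda>N. norm (\<Prod>n<N. blaschke_factor (a n) z)) \<longlonglongrightarrow> norm (blaschke_product a z)"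
    by (intro tendsto_norm blaschke_partial_products_tendsto z)
  show "\<forall>N\<ge>Suc n. norm (\<Prod>n<N. blaschke_factor (a n) z) \<le> pseudohyperbolic_dist z (a n)"
  proof (intro allI impI)
    fix N assume "Suc n \<le> N"
    then have "norm (\<Prod>n<N. blaschke_factor (a n) z) =
        norm (blaschke_factor (a n) z) * (\<Prod>k\<in>{..<N}-{n}. norm (blaschke_factor (a k) z))"
      by (subst prod.remove[of "{..<N}" n]) (auto simp: norm_mult prod_norm)
    also have "\<dots> \<le> norm (blaschke_factor (a n) z) * 1"
      by (intro mult_left_mono prod_le_1) (use norm_blaschke_factor_le_1 zero_norms z in auto)
    finally show "norm (\<Prod>n<N. blaschke_factor (a n) z) \<le> pseudohyperbolic_dist z (a n)"
      by (simp only: pseudohyperbolic_dist_eq_norm_blaschke_factor[OF zero_norms(3)] mult_1_right)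
  qed
qed

lemma norm_blaschke_product_le_1:
  assumes z: "norm z < 1"
  shows "norm (blaschke_product a z) \<le> 1"
proof -
  have "norm (blaschke_product a z) \<le> pseudohyperbolic_dist z (a 0)"
    by (rule norm_blaschke_product_le_pseudohyperbolic[OF z])
  also have "\<dots> = norm (blaschke_factor (a 0) z)"
    by (rule pseudohyperbolic_dist_eq_norm_blaschke_factor[OF zero_norms(3)])
  also have "\<dots> \<le> 1"
    using z zero_norms by (intro norm_blaschke_factor_le_1) auto
  finally show ?thesis .
qed

end

text \<open>
  Cauchy's inequality on the discs around \<open>z\<close> inside the unit disc.
\<close>

lemma norm_deriv_le_inverse_boundary_distance:
  assumes f: "f holomorphic_on ball 0 1" and le: "\<And>z. norm z < 1 \<Longrightarrow> norm (f z) \<le> 1"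
    and z: "norm z < 1"
  shows "norm (deriv f z) \<le> 1 / (1 - norm z)"
proof -
  have *: "norm (deriv f z) * r \<le> 1" if r: "0 < r" "r < 1 - norm z" for r
  proof -
    have sub: "cball z r \<subseteq> ball 0 1"
      using r by (simp add: cball_subset_ball_iff)
    have "norm ((deriv ^^ 1) f z) \<le> fact 1 * 1 / r ^ 1"
    proof (rule Cauchy_inequality)
      show "f holomorphic_on ball z r" "continuous_on (cball z r) f"
        using sub ball_subset_cball[of z r]
        by (blast intro: holomorphic_on_subset[OF f]
            continuous_on_subset[OF holomorphic_on_imp_continuous_on[OF f]])+
      show "norm (f x) \<le> 1" if "norm (z - x) = r" for x
      proof -
        have "x \<in> cball z r" using that by (simp add: dist_norm)
        then show ?thesis using sub by (intro le) auto
      qed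
    qed (use r in auto)
    then show ?thesis using r by (simp add: field_simps)
  qed
  have "norm (deriv f z) * (1 - norm z) \<le> 1"
  proof (rule field_le_mult_one_interval)
    fix x :: real assume x: "0 < x" "x < 1"
    then show "x * (norm (deriv f z) * (1 - norm z)) \<le> 1"
      using *[of "x * (1 - norm z)"] z by (simp add: mult_ac)
  qed
  then show "norm (deriv f z) \<le> 1 / (1 - norm z)"
    using z by (simp add: field_simps)
qed

section \<open>Circle means of Blaschke products\<close>

lemma holomorphic_circle_mean:
  assumes "continuous_on (cball 0 R) f" "f holomorphic_on ball 0 R" "0 < R"
  shows "((\<lambda>t. f (of_real R * cis t)) has_integral (of_real (2 * pi) * f 0)) {0..2 * pi}"
proof -
  have "((\<lambda>u. f u / (u - 0)) has_contour_integral (2 * of_real pi * \<i> * f 0)) (circlepath 0 R)"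
    by (rule Cauchy_integral_circlepath) (use assms in auto)
  then have "((\<lambda>t. f (of_real R * cis t) / (of_real R * cis t) * of_real R * \<i> * cis t)
      has_integral (2 * of_real pi * \<i> * f 0)) {0..2 * pi}"
    unfolding circlepath_def by (subst (asm) has_contour_integral_part_circlepath_iff) auto
  moreover have "(\<lambda>t. f (of_real R * cis t) / (of_real R * cis t) * of_real R * \<i> * cis t)
      = (\<lambda>t. \<i> * f (of_real R * cis t))"
    using assms(3) by (auto simp: fun_eq_iff)
  ultimately have "((\<lambda>t. \<i> * f (of_real R * cis t)) has_integral (2 * of_real pi * \<i> * f 0)) {0..2 * pi}"
    by metis
  from has_integral_mult_right[OF this, of "-\<i>"] show ?thesis
    by (simp add: mult.assoc[symmetric]) (simp add: mult_ac)
qed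

lemma norm_center_le_circle_mean:
  assumes "continuous_on (cball 0 R) f" "f holomorphic_on ball 0 R" "0 < R"
  shows "2 * pi * norm (f 0) \<le> integral {0..2 * pi} (\<lambda>t. norm (f (of_real R * cis t)))"
proof -
  have cont: "continuous_on {0..2*pi} (\<lambda>t. f (of_real R * cis t))"
    by (rule continuous_on_compose2[OF assms(1)])
       (use assms(3) in \<open>auto intro!: continuous_intros simp: norm_mult\<close>)
  have "2 * pi * norm (f 0) = norm (integral {0..2 * pi} (\<lambda>t. f (of_real R * cis t)))"
    using integral_unique[OF holomorphic_circle_mean[OF assms]] by (simp add: norm_mult)
  also have "\<dots> \<le> integral {0..2 * pi} (\<lambda>t. norm (f (of_real R * cis t)))"
    by (intro integral_norm_bound_integral integrable_continuous_interval continuous_intros cont) auto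
  finally show ?thesis .
qed

text \<open>
  Split a partial product into a fixed head \<open>P\<close> and a middle part \<open>Q\<close>.  The head is continuous
  on the closed disc and unimodular on the circle, so it is uniformly close to 1 in modulus near the circle.
  For the middle part, the mean of \<open>|Q|\<close> is at least \<open>|Q(0)|\<close>, the product of the moduli
  of its zeros, which is close to 1 by the Blaschke condition.  Since \<open>R\<close> is chosen before the length of
  \<open>Q\<close>, the partial products converge uniformly on the circle of radius \<open>R\<close>, and the
  estimate passes to \<open>B\<close>.
\<close>

lemma blaschke_defect_circle_mean_small:
  assumes bl: "blaschke_sequence a" and e: "0 < e" and r0: "r0 < (1::real)"
  obtains R where "0 < R" "r0 < R" "R < 1"
    "integral {0..2 * pi} (\<lambda>t. 1 - norm (blaschke_product a (of_real R * cis t))) \<le> e"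
proof -
  note nrm = zero_norms[OF bl]
  \<comment> \<open>Three errors of size \<open>2 * pi * e1\<close> add up: the head, the mean of the middle part, and the
    remaining infinite tail.\<close>
  define e1 where "e1 = e / (6 * pi)"
  have e1: "e1 > 0" using e by (simp add: e1_def)
  define P where "P = (\<lambda>A z. \<Prod>n\<in>A. blaschke_factor (a n) z)"
  have contP: "continuous_on (cball 0 1) (P A)" for A
    unfolding P_def by (intro continuous_intros continuous_on_blaschke_factor nrm)
  have holP: "P A holomorphic_on ball 0 1" for A
    unfolding P_def by (intro holomorphic_intros holomorphic_blaschke_factor nrm)
  have P_le_1: "norm (P A z) \<le> 1" if "norm z \<le> 1" for A z
    unfolding P_def prod_norm[symmetric]
    by (intro prod_le_1) (use norm_blaschke_factor_le_1 nrm that in auto)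
  have "summable (\<lambda>n. 1 - norm (a n))"
    using bl by (simp add: blaschke_sequence_def)
  then obtain N where N: "\<And>m n. m \<ge> N \<Longrightarrow> norm (\<Sum>k=m..<n. 1 - norm (a k)) < e1"
    using e1 unfolding summable_Cauchy by meson
  have "uniformly_continuous_on (cball 0 1) (P {..<N})"
    by (rule compact_uniformly_continuous[OF contP]) auto
  then obtain d where d: "d > 0"
    "\<And>x y. x \<in> cball 0 1 \<Longrightarrow> y \<in> cball 0 1 \<Longrightarrow> dist y x < d \<Longrightarrow> dist (P {..<N} y) (P {..<N} x) < e1"
    using e1 unfolding uniformly_continuous_on_def by meson
  obtain R where "max (max r0 0) (1 - d) < R" "R < 1"
    using dense[of "max (max r0 0) (1 - d)" 1] r0 d by auto
  then have R: "r0 < R" "0 < R" "1 - d < R" "R < 1" by auto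
  \<comment> \<open>Compare with the point \<open>cis t\<close> of the unit circle on the same ray.\<close>
  have head: "norm (P {..<N} (of_real R * cis t)) \<ge> 1 - e1" for t
  proof -
    have "dist (of_real R * cis t) (cis t) = norm (of_real (R - 1) * cis t)"
      by (simp add: dist_norm algebra_simps)
    also have "\<dots> < d"
      using R by (simp add: norm_mult del: of_real_diff)
    finally have "dist (P {..<N} (of_real R * cis t)) (P {..<N} (cis t)) < e1"
      using R by (intro d) (auto simp: norm_mult)
    moreover have "norm (P {..<N} (cis t)) = 1"
      unfolding P_def prod_norm[symmetric] by (simp add: norm_blaschke_factor_sphere nrm)
    moreover have "norm (P {..<N} (cis t)) - norm (P {..<N} (of_real R * cis t))
        \<le> dist (P {..<N} (of_real R * cis t)) (P {..<N} (cis t))"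
      by (metis dist_commute dist_norm norm_triangle_ineq2)
    ultimately show ?thesis by linarith
  qed
  have "\<forall>\<^sub>F M in sequentially. \<forall>z\<in>cball 0 R. dist (P {..<M} z) (blaschke_product a z) < e1"
    using uniform_limit_blaschke_partial_products[OF bl \<open>R < 1\<close>] e1
    unfolding uniform_limit_iff P_def by blast
  then obtain M where M: "M \<ge> N" "\<And>z. z \<in> cball 0 R \<Longrightarrow> dist (P {..<M} z) (blaschke_product a z) < e1"
    unfolding eventually_sequentially by (metis nat_le_linear)
  define Q where "Q = P {N..<M}"
  have PM: "P {..<M} z = P {..<N} z * Q z" for z
    unfolding P_def Q_def using M(1)
    by (subst prod.union_disjoint[symmetric]) (auto simp: ivl_disj_un ivl_disj_int)
  have sub: "cball (0::complex) R \<subseteq> cball 0 1" "ball (0::complex) R \<subseteq> ball 0 1"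
    using R by auto
  have Q0: "1 - e1 \<le> norm (Q 0)"
  proof -
    have "1 - (\<Sum>n=N..<M. 1 - norm (a n)) \<le> (\<Prod>n=N..<M. 1 - (1 - norm (a n)))"
      by (rule Weierstrass_prod_ineq) (use nrm in \<open>auto intro: less_imp_le\<close>)
    also have "\<dots> = norm (Q 0)"
      by (simp add: Q_def P_def prod_norm[symmetric] blaschke_factor_0 nrm)
    finally show ?thesis using N[of N M] by auto
  qed
  have "2 * pi * (1 - e1) \<le> 2 * pi * norm (Q 0)"
    using Q0 by simp
  also have "\<dots> \<le> integral {0..2 * pi} (\<lambda>t. norm (Q (of_real R * cis t)))"
    unfolding Q_def
    by (rule norm_center_le_circle_mean)
       (use R sub in \<open>auto intro: continuous_on_subset[OF contP] holomorphic_on_subset[OF holP]\<close>)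
  finally have Qmean: "2 * pi * (1 - e1) \<le> integral {0..2 * pi} (\<lambda>t. norm (Q (of_real R * cis t)))" .
  have inball: "of_real R * cis t \<in> cball 0 R" for t
    using R by (auto simp: norm_mult)
  have contB: "continuous_on {0..2*pi} (\<lambda>t. blaschke_product a (of_real R * cis t))"
    by (rule continuous_on_compose2[OF holomorphic_on_imp_continuous_on[OF holomorphic_blaschke_product[OF bl]]])
       (use R in \<open>auto intro!: continuous_intros simp: norm_mult\<close>)
  have contQ: "continuous_on {0..2*pi} (\<lambda>t. Q (of_real R * cis t))"
    unfolding Q_def by (rule continuous_on_compose2[OF contP])
       (use R in \<open>auto intro!: continuous_intros simp: norm_mult\<close>)
  have "integral {0..2 * pi} (\<lambda>t. 1 - norm (blaschke_product a (of_real R * cis t)))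
      \<le> integral {0..2 * pi} (\<lambda>t. 2 * e1 + 1 - norm (Q (of_real R * cis t)))"
  proof (intro integral_le integrable_continuous_interval continuous_intros contB contQ)
    fix t
    let ?z = "of_real R * cis t"
    have z1: "norm ?z \<le> 1" using R by (simp add: norm_mult)
    have "norm (P {..<M} ?z) \<le> norm (blaschke_product a ?z) + e1"
      using M(2)[OF inball[of t]] norm_triangle_ineq2[of "P {..<M} ?z" "blaschke_product a ?z"]
      by (simp add: dist_norm)
    moreover have "norm (Q ?z) - e1 \<le> norm (P {..<M} ?z)"
    proof -
      have "norm (Q ?z) - e1 \<le> norm (Q ?z) - e1 * norm (Q ?z)"
        using mult_left_mono[of "norm (Q ?z)" 1 e1] P_le_1[OF z1] e1 by (simp add: Q_def)
      also have "\<dots> = (1 - e1) * norm (Q ?z)" by (simp add: algebra_simps)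
      also have "\<dots> \<le> norm (P {..<N} ?z) * norm (Q ?z)"
        by (intro mult_right_mono head) auto
      finally show ?thesis by (simp add: PM norm_mult)
    qed
    ultimately show "1 - norm (blaschke_product a ?z) \<le> 2 * e1 + 1 - norm (Q ?z)"
      by linarith
  qed
  also have "\<dots> = 2 * pi * (2 * e1 + 1) - integral {0..2 * pi} (\<lambda>t. norm (Q (of_real R * cis t)))"
    by (subst integral_diff) (auto intro!: integrable_continuous_interval continuous_intros contQ)
  also have "\<dots> \<le> 6 * pi * e1"
    using Qmean by (simp add: algebra_simps)
  also have "\<dots> = e" by (simp add: e1_def)
  finally show thesis using R that by blast
qed

section \<open>Polar coordinates\<close>

lemma measurable_case_prod_Complex [measurable]:
  "(\<lambda>(x, y). Complex x y) \<in> borel \<Otimes>\<^sub>M borel \<rightarrow>\<^sub>M borel"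
  unfolding borel_prod by (rule borel_measurable_continuous_onI)
    (auto simp: split_beta Complex_eq intro!: continuous_intros)

lemma measurable_Complex [measurable (raw)]:
  assumes [measurable]: "f \<in> borel_measurable M" "g \<in> borel_measurable M"
  shows "(\<lambda>w. Complex (f w) (g w)) \<in> borel_measurable M"
  unfolding Complex_eq by measurable

lemma lborel_complex_eq_distr:
  "lborel = distr (lborel \<Otimes>\<^sub>M lborel) borel (\<lambda>(x, y). Complex x y)"
proof (rule lborel_eqI)
  fix l u :: complex assume le: "\<And>b. b \<in> Basis \<Longrightarrow> l \<bullet> b \<le> u \<bullet> b"
  have le': "Re l \<le> Re u" "Im l \<le> Im u"
    using le[of 1] le[of \<i>] by (auto simp: Basis_complex_def)
  have eq: "(\<lambda>(x, y). Complex x y) -` box l u = {Re l<..<Re u} \<times> {Im l<..<Im u}"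
    by (auto simp: in_box_complex_iff)
  show "emeasure (distr (lborel \<Otimes>\<^sub>M lborel) borel (\<lambda>(x, y). Complex x y)) (box l u)
      = ennreal (\<Prod>b\<in>Basis. (u - l) \<bullet> b)"
    by (subst emeasure_distr)
       (use le' in \<open>auto simp: eq space_pair_measure lborel.emeasure_pair_measure_Times
          Basis_complex_def ennreal_mult\<close>)
qed simp

lemma nn_integral_complex_eq_iterated:
  fixes f :: "complex \<Rightarrow> ennreal"
  assumes [measurable]: "f \<in> borel_measurable borel"
  shows "(\<integral>\<^sup>+z. f z \<partial>lborel) = (\<integral>\<^sup>+x. \<integral>\<^sup>+y. f (Complex x y) \<partial>lborel \<partial>lborel)"
proof -
  have "(\<integral>\<^sup>+z. f z \<partial>lborel) = (\<integral>\<^sup>+w. f (case w of (x, y) \<Rightarrow> Complex x y) \<partial>(lborel \<Otimes>\<^sub>M lborel))"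
    by (subst lborel_complex_eq_distr, subst nn_integral_distr) auto
  also have "\<dots> = (\<integral>\<^sup>+x. \<integral>\<^sup>+y. f (Complex x y) \<partial>lborel \<partial>lborel)"
    by (subst lborel.nn_integral_fst[symmetric]) auto
  finally show ?thesis .
qed

lemma nn_integral_mult_ii:
  fixes f :: "complex \<Rightarrow> ennreal"
  assumes [measurable]: "f \<in> borel_measurable borel"
  shows "(\<integral>\<^sup>+z. f (\<i> * z) \<partial>lborel) = (\<integral>\<^sup>+z. f z \<partial>lborel)"
proof -
  have "(\<integral>\<^sup>+z. f (\<i> * z) \<partial>lborel) = (\<integral>\<^sup>+x. \<integral>\<^sup>+y. f (\<i> * Complex x y) \<partial>lborel \<partial>lborel)"
    by (rule nn_integral_complex_eq_iterated) measurable
  also have "\<dots> = (\<integral>\<^sup>+x. \<integral>\<^sup>+y. f (Complex (- y) x) \<partial>lborel \<partial>lborel)"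
  proof -
    have "\<i> * Complex x y = Complex (- y) x" for x y
      by (simp add: complex_eq_iff)
    then show ?thesis by simp
  qed
  also have "\<dots> = (\<integral>\<^sup>+y. \<integral>\<^sup>+x. f (Complex (- y) x) \<partial>lborel \<partial>lborel)"
    by (rule lborel_pair.Fubini') measurable
  also have "\<dots> = (\<integral>\<^sup>+y. \<integral>\<^sup>+x. f (Complex y x) \<partial>lborel \<partial>lborel)"
    by (subst (2) nn_integral_real_affine[where c = "-1" and t = 0]) auto
  also have "\<dots> = (\<integral>\<^sup>+z. f z \<partial>lborel)"
    by (rule nn_integral_complex_eq_iterated[symmetric]) measurable
  finally show ?thesis .
qed

lemma measurable_cis [measurable]: "cis \<in> borel_measurable borel"
  by (intro borel_measurable_continuous_onI continuous_intros)

lemma ennreal_mult_indicator_eq: "ennreal x * indicator A y = ennreal (x * indicator A y)"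
  by (simp add: indicator_def)

text \<open>
  On the sector \<open>|y| \<le> x\<close>, polar coordinates split into two substitutions in one variable:
  \<open>y = x tan t\<close> for fixed \<open>x\<close>, and after exchanging the integrals
  \<open>x = r cos t\<close> for fixed \<open>t\<close>.  The Jacobians multiply to
  \<open>x / cos\<^sup>2 t * cos t = r\<close>.
\<close>

lemma nn_integral_polar_sector_le:
  fixes g :: "complex \<Rightarrow> real"
  assumes [measurable]: "g \<in> borel_measurable borel" and g: "\<And>z. 0 \<le> g z"
  shows "(\<integral>\<^sup>+t\<in>{-(pi/4)..pi/4}. (\<integral>\<^sup>+r\<in>{0<..}. ennreal (r * g (of_real r * cis t)) \<partial>lborel) \<partial>lborel)
    \<le> (\<integral>\<^sup>+z. ennreal (g z) \<partial>lborel)"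
proof -
  let ?I = "{-(pi/4)..pi/4}"
  have cos_pos: "cos t > 0" if "t \<in> ?I" for t
  proof (rule cos_gt_zero_pi)
    have "- (pi / 4) \<le> t" "t \<le> pi / 4" using that by auto
    then show "- (pi / 2) < t" "t < pi / 2" using pi_gt_zero by linarith+
  qed
  have "(\<integral>\<^sup>+t\<in>?I. (\<integral>\<^sup>+r\<in>{0<..}. ennreal (r * g (of_real r * cis t)) \<partial>lborel) \<partial>lborel)
      = (\<integral>\<^sup>+t\<in>?I. (\<integral>\<^sup>+x\<in>{0<..}. ennreal (g (Complex x (x * tan t)) * (x * inverse ((cos t)\<^sup>2))) \<partial>lborel) \<partial>lborel)"
  proof (intro nn_integral_cong, goal_cases)
    case (1 t)
    show ?case
    proof (cases "t \<in> ?I")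
      case True
      note c = cos_pos[OF True]
      have "(\<integral>\<^sup>+x\<in>{0<..}. ennreal (g (Complex x (x * tan t)) * (x * inverse ((cos t)\<^sup>2))) \<partial>lborel)
        = ennreal (cos t) * (\<integral>\<^sup>+r. ennreal (g (Complex (cos t * r) (cos t * r * tan t)) * (cos t * r * inverse ((cos t)\<^sup>2)))
            * indicator {0<..} (cos t * r) \<partial>lborel)"
        using c by (subst nn_integral_real_affine[where c = "cos t" and t = 0]) auto
      also have "\<dots> = (\<integral>\<^sup>+r. ennreal (cos t) * (ennreal (g (Complex (cos t * r) (cos t * r * tan t)) * (cos t * r * inverse ((cos t)\<^sup>2)))
            * indicator {0<..} (cos t * r)) \<partial>lborel)"
        by (rule nn_integral_cmult[symmetric]) measurable
      also have "\<dots> = (\<integral>\<^sup>+r\<in>{0<..}. ennreal (r * g (of_real r * cis t)) \<partial>lborel)"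
      proof (intro nn_integral_cong)
        fix r :: real
        have "Complex (cos t * r) (cos t * r * tan t) = of_real r * cis t"
          using c by (simp add: complex_eq_iff tan_def)
        then show "ennreal (cos t) * (ennreal (g (Complex (cos t * r) (cos t * r * tan t)) * (cos t * r * inverse ((cos t)\<^sup>2)))
            * indicator {0<..} (cos t * r)) = ennreal (r * g (of_real r * cis t)) * indicator {0<..} r"
          using c g by (auto simp: indicator_def zero_less_mult_iff ennreal_mult[symmetric] field_simps power2_eq_square)
      qed
      finally show ?thesis by simp
    qed simp
  qed
  also have "\<dots> = (\<integral>\<^sup>+t. \<integral>\<^sup>+x. ennreal (g (Complex x (x * tan t)) * (x * inverse ((cos t)\<^sup>2)))
      * indicator {0<..} x * indicator ?I t \<partial>lborel \<partial>lborel)"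
    by (subst nn_integral_multc) (auto simp: tan_def)
  also have "\<dots> = (\<integral>\<^sup>+x. \<integral>\<^sup>+t. ennreal (g (Complex x (x * tan t)) * (x * inverse ((cos t)\<^sup>2)))
      * indicator {0<..} x * indicator ?I t \<partial>lborel \<partial>lborel)"
    by (rule lborel_pair.Fubini') (simp add: tan_def)
  also have "\<dots> \<le> (\<integral>\<^sup>+x. \<integral>\<^sup>+y. ennreal (g (Complex x y)) \<partial>lborel \<partial>lborel)"
  proof (rule nn_integral_mono)
    fix x :: real
    show "(\<integral>\<^sup>+t. ennreal (g (Complex x (x * tan t)) * (x * inverse ((cos t)\<^sup>2)))
        * indicator {0<..} x * indicator ?I t \<partial>lborel) \<le> (\<integral>\<^sup>+y. ennreal (g (Complex x y)) \<partial>lborel)"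
    proof (cases "x > 0")
      case True
      have "(\<integral>\<^sup>+y. ennreal (g (Complex x y)) * indicator {x * tan (-(pi/4))..x * tan (pi/4)} y \<partial>lborel)
        = (\<integral>\<^sup>+t. ennreal (g (Complex x (x * tan t)) * (x * inverse ((cos t)\<^sup>2))) * indicator ?I t \<partial>lborel)"
      proof (subst (1 2) ennreal_mult_indicator_eq, rule nn_integral_substitution[where g = "\<lambda>t. x * tan t"
            and g' = "\<lambda>t. x * inverse ((cos t)\<^sup>2)" and f = "\<lambda>y. g (Complex x y)"])
        show "set_borel_measurable borel {x * tan (-(pi/4))..x * tan (pi/4)} (\<lambda>y. g (Complex x y))"
          unfolding set_borel_measurable_def by measurable
        show "((\<lambda>t. x * tan t) has_real_derivative x * inverse ((cos t)\<^sup>2)) (at t)" if "t \<in> ?I" for t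
          using cos_pos[OF that] by (intro DERIV_cmult DERIV_tan) auto
        show "continuous_on ?I (\<lambda>t. x * inverse ((cos t)\<^sup>2))"
          by (intro continuous_intros) (use cos_pos in force)
      qed (use True in auto)
      moreover have "(\<integral>\<^sup>+y. ennreal (g (Complex x y)) * indicator {x * tan (-(pi/4))..x * tan (pi/4)} y \<partial>lborel)
        \<le> (\<integral>\<^sup>+y. ennreal (g (Complex x y)) \<partial>lborel)"
        by (intro nn_integral_mono) (auto simp: indicator_def)
      ultimately show ?thesis using True by simp
    qed simp
  qed
  also have "\<dots> = (\<integral>\<^sup>+z. ennreal (g z) \<partial>lborel)"
    by (rule nn_integral_complex_eq_iterated[symmetric]) measurable
  finally show ?thesis .
qed

text \<open>
  Area is invariant under multiplication by \<open>\<i>\<close>, which moves the sector by a quarter turn.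
\<close>

lemma nn_integral_polar_rotated_sector_le:
  fixes g :: "complex \<Rightarrow> real" and k :: nat
  assumes [measurable]: "g \<in> borel_measurable borel" and g: "\<And>z. 0 \<le> g z"
  shows "(\<integral>\<^sup>+t\<in>{k * pi/2 - pi/4..k * pi/2 + pi/4}.
      (\<integral>\<^sup>+r\<in>{0<..}. ennreal (r * g (of_real r * cis t)) \<partial>lborel) \<partial>lborel)
    \<le> (\<integral>\<^sup>+z. ennreal (g z) \<partial>lborel)"
  using assms
proof (induction k arbitrary: g)
  case 0
  then show ?case using nn_integral_polar_sector_le[of g] by simp
next
  case (Suc k)
  note [measurable] = Suc.prems(1)
  let ?H = "\<lambda>g t. \<integral>\<^sup>+r\<in>{0<..}. ennreal (r * g (of_real r * cis t)) \<partial>lborel"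
  have "(\<integral>\<^sup>+t\<in>{Suc k * pi/2 - pi/4..Suc k * pi/2 + pi/4}. ?H g t \<partial>lborel)
      = (\<integral>\<^sup>+t. ?H g (pi/2 + 1 * t) * indicator {Suc k * pi/2 - pi/4..Suc k * pi/2 + pi/4} (pi/2 + 1 * t) \<partial>lborel)"
    by (subst nn_integral_real_affine[where c = 1 and t = "pi/2"]) auto
  also have "\<dots> = (\<integral>\<^sup>+t\<in>{k * pi/2 - pi/4..k * pi/2 + pi/4}. ?H (\<lambda>z. g (\<i> * z)) t \<partial>lborel)"
  proof (intro nn_integral_cong)
    fix t :: real
    have "cis (pi/2 + 1 * t) = \<i> * cis t"
      by (simp flip: cis_mult)
    moreover have "indicator {Suc k * pi/2 - pi/4..Suc k * pi/2 + pi/4} (pi/2 + 1 * t)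
        = (indicator {k * pi/2 - pi/4..k * pi/2 + pi/4} t :: ennreal)"
      by (auto simp: indicator_def field_simps)
    ultimately show "?H g (pi/2 + 1 * t) * indicator {Suc k * pi/2 - pi/4..Suc k * pi/2 + pi/4} (pi/2 + 1 * t)
      = ?H (\<lambda>z. g (\<i> * z)) t * indicator {k * pi/2 - pi/4..k * pi/2 + pi/4} t"
      by (simp add: mult_ac)
  qed
  also have "\<dots> \<le> (\<integral>\<^sup>+z. ennreal (g (\<i> * z)) \<partial>lborel)"
    by (rule Suc.IH) (use Suc.prems in auto)
  also have "\<dots> = (\<integral>\<^sup>+z. ennreal (g z) \<partial>lborel)"
    by (rule nn_integral_mult_ii[of "\<lambda>z. ennreal (g z)"]) measurable
  finally show ?case .
qed

text \<open>
  Five quarter-turn sectors cover all angles in \<open>[0, 2\<pi>]\<close>; the first one starts at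
  \<open>-\<pi>/4\<close>, so four would not be enough.
\<close>

lemma nn_integral_polar_le:
  fixes g :: "complex \<Rightarrow> real"
  assumes [measurable]: "g \<in> borel_measurable borel" and g: "\<And>z. 0 \<le> g z"
  shows "(\<integral>\<^sup>+t\<in>{0..2*pi}. (\<integral>\<^sup>+r\<in>{0<..}. ennreal (r * g (of_real r * cis t)) \<partial>lborel) \<partial>lborel)
    \<le> 5 * (\<integral>\<^sup>+z. ennreal (g z) \<partial>lborel)"
proof -
  let ?H = "\<lambda>t. \<integral>\<^sup>+r\<in>{0<..}. ennreal (r * g (of_real r * cis t)) \<partial>lborel"
  let ?J = "\<lambda>k::nat. {k * pi/2 - pi/4..k * pi/2 + pi/4}"
  have cover: "indicator {0..2*pi} t \<le> (\<Sum>k<5. indicator (?J k) t :: ennreal)" for t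
  proof (cases "t \<in> {0..2*pi}")
    case True
    have "t \<in> ?J 0 \<or> t \<in> ?J 1 \<or> t \<in> ?J 2 \<or> t \<in> ?J 3 \<or> t \<in> ?J 4"
      using True by (auto simp: field_simps)
    then have "\<exists>k\<in>{0, 1, 2, 3, 4::nat}. t \<in> ?J k"
      by blast
    also have "{0, 1, 2, 3, 4::nat} = {..<5}"
      by auto
    finally obtain k where k: "k \<in> {..<5::nat}" "t \<in> ?J k" by blast
    have "indicator (?J k) t \<le> (\<Sum>k<5. indicator (?J k) t :: ennreal)"
      by (rule member_le_sum) (use k in auto)
    then show ?thesis using k(2) True by simp
  qed simp
  have "(\<integral>\<^sup>+t\<in>{0..2*pi}. ?H t \<partial>lborel) \<le> (\<integral>\<^sup>+t. (\<Sum>k<5. ?H t * indicator (?J k) t) \<partial>lborel)"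
    by (intro nn_integral_mono) (use cover in \<open>auto simp: sum_distrib_left[symmetric] intro!: mult_left_mono\<close>)
  also have "\<dots> = (\<Sum>k<5. \<integral>\<^sup>+t. ?H t * indicator (?J k) t \<partial>lborel)"
    by (rule nn_integral_sum) measurable
  also have "\<dots> \<le> (\<Sum>k<5::nat. \<integral>\<^sup>+z. ennreal (g z) \<partial>lborel)"
    by (intro sum_mono nn_integral_polar_rotated_sector_le) (use g in auto)
  finally show ?thesis by simp
qed

section \<open>A Hardy inequality along a ray\<close>

lemma nn_integral_continuous_Icc:
  fixes f :: "real \<Rightarrow> real"
  assumes cont: "continuous_on {a..b} f" and nonneg: "\<And>x. x \<in> {a..b} \<Longrightarrow> 0 \<le> f x"
  shows "(\<integral>\<^sup>+x\<in>{a..b}. ennreal (f x) \<partial>lborel) = ennreal (integral {a..b} f)"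
proof -
  have "(f has_integral integral {a..b} f) {a..b}"
    by (intro integrable_integral integrable_continuous_interval cont)
  then show ?thesis
    by (rule nn_integral_has_integral_lebesgue'[rotated]) (use nonneg in auto)
qed

text \<open>
  If \<open>x\<close> exceeds the threshold \<open>l\<close>, then \<open>(x / l)\<^sup>p \<ge> 1\<close>, and the a priori bound \<open>1 / d\<close> on
  \<open>x\<close> does the rest.  In the application \<open>x\<close> is \<open>|B'|\<close> at a point and \<open>d\<close> is the distance from that point
  to the unit circle: the factor \<open>1 / d\<close> stands in for one more power of \<open>x\<close>, so that exponents
  \<open>p \<le> 1\<close> are covered although the usual splitting \<open>x \<le> l + (x / l)\<^sup>p l\<close> needs \<open>p \<ge> 1\<close>.
\<close>

lemma young_split:
  fixes x l d p :: real
  assumes "0 \<le> x" "0 < l" "0 < d" "0 < p" "x \<le> 1 / d"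
  shows "x \<le> l + (x / l) powr p / d"
proof (cases "x \<le> l")
  case True
  have "0 \<le> (x / l) powr p / d" using assms by simp
  then show ?thesis using True by linarith
next
  case False
  then have "1 \<le> (x / l) powr p"
    using assms by (intro ge_one_powr_ge_zero) auto
  then have "1 / d \<le> (x / l) powr p / d"
    using assms by (intro divide_right_mono) auto
  then show ?thesis using assms by linarith
qed

lemma nn_integral_powr_boundary_le:
  fixes u v c :: real
  assumes "u \<le> v" "v < 1" "0 < c"
  shows "(\<integral>\<^sup>+s\<in>{u..v}. ennreal ((1 - s) powr (c - 1)) \<partial>lborel) \<le> ennreal ((1 - u) powr c / c)"
proof -
  have "(\<integral>\<^sup>+s\<in>{u..v}. ennreal ((1 - s) powr (c - 1)) \<partial>lborel)
      = ennreal (- ((1 - v) powr c / c) - - ((1 - u) powr c / c))"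
  proof (rule nn_integral_FTC_Icc)
    fix s assume "s \<in> {u..v}"
    then show "((\<lambda>s. - ((1 - s) powr c / c)) has_real_derivative (1 - s) powr (c - 1)) (at s)"
      using assms by (auto intro!: derivative_eq_intros)
  qed (use assms in auto)
  also have "\<dots> \<le> ennreal ((1 - u) powr c / c)"
    using assms by (intro ennreal_leI) auto
  finally show ?thesis .
qed

lemma nn_integral_powr_boundary_neg_le:
  fixes u v c :: real
  assumes "u \<le> v" "v < 1" "0 < c" 
  shows "(\<integral>\<^sup>+s\<in>{u..v}. ennreal ((1 - s) powr (- c - 1)) \<partial>lborel) \<le> ennreal ((1 - v) powr (- c) / c)"
proof -
  have "(\<integral>\<^sup>+s\<in>{u..v}. ennreal ((1 - s) powr (- c - 1)) \<partial>lborel)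
      = ennreal ((1 - v) powr (- c) / c - (1 - u) powr (- c) / c)"
  proof (rule nn_integral_FTC_Icc)
    fix s assume "s \<in> {u..v}"
    then show "((\<lambda>s. (1 - s) powr (- c) / c) has_real_derivative (1 - s) powr (- c - 1)) (at s)"
      using assms by (auto intro!: derivative_eq_intros)
  qed (use assms in auto)
  also have "\<dots> \<le> ennreal ((1 - v) powr (- c) / c)"
    using assms by (intro ennreal_leI) auto
  finally show ?thesis .
qed

text \<open>
  With \<open>\<eta> = \<kappa> / (2 * p)\<close> this is \<open>(\<eta> / 4)\<^bsup>-p\<^esup>\<close>, the price of the threshold
  in \<open>radial_integral_split\<close>.
\<close>

definition hardy_const :: "real \<Rightarrow> real \<Rightarrow> real" where
  "hardy_const p \<kappa> = (\<kappa> / (8 * p)) powr (- p)"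

text \<open>
  Apply \<open>young_split\<close> at each \<open>s\<close> with the threshold
  \<open>l(s) = \<eta>/4 (1 - r)\<^bsup>-\<eta>\<^esup> (1 - s)\<^bsup>\<eta>-1\<^esup>\<close>.  It is normalised so that its
  integral over \<open>[r, 1)\<close> is 1/4, while the exponent \<open>\<eta> = \<kappa> / (2 p)\<close> leaves half of \<open>\<kappa>\<close> for
  the integration over \<open>r\<close> in \<open>radial_hardy_inequality\<close>.
\<close>

lemma radial_integral_split:
  fixes g :: "real \<Rightarrow> real"
  assumes [measurable]: "g \<in> borel_measurable borel" and g0: "\<And>s. 0 \<le> g s"
    and gle: "\<And>s. 0 < s \<Longrightarrow> s < 1 \<Longrightarrow> g s \<le> 1 / (1 - s)"
    and \<kappa>: "0 < \<kappa>" "\<kappa> < p" and r: "0 < r" "r \<le> R" "R < 1"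
  shows "(\<integral>\<^sup>+s\<in>{r..R}. ennreal (g s) \<partial>lborel) \<le> ennreal (1 / 4) +
    ennreal (hardy_const p \<kappa> * (1 - r) powr (\<kappa> / 2)) *
      (\<integral>\<^sup>+s\<in>{r..R}. ennreal (g s powr p * (1 - s) powr (p - \<kappa> / 2 - 1)) \<partial>lborel)"
proof -
  define \<eta> where "\<eta> = \<kappa> / (2 * p)"
  have p: "0 < p" using \<kappa> by simp
  have \<eta>: "0 < \<eta>" "\<eta> * p = \<kappa> / 2" using \<kappa> p by (auto simp: \<eta>_def)
  have K: "hardy_const p \<kappa> = (\<eta> / 4) powr (- p)"
    by (simp add: hardy_const_def \<eta>_def)
  define l where "l = (\<lambda>s. \<eta> / 4 * (1 - r) powr (- \<eta>) * (1 - s) powr (\<eta> - 1))"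
  define w where "w = (\<lambda>s. hardy_const p \<kappa> * (1 - r) powr (\<kappa> / 2) * (g s powr p * (1 - s) powr (p - \<kappa> / 2 - 1)))"
  have K0: "0 \<le> hardy_const p \<kappa>" by (simp add: hardy_const_def)
  have split: "g s \<le> l s + w s" if s: "s \<in> {r..R}" for s
  proof -
    have s1: "0 < 1 - s" "0 < 1 - r" using s r by auto
    have l: "0 < l s" using s1 \<eta> by (simp add: l_def)
    have "(g s / l s) powr p / (1 - s) = g s powr p * (l s powr (- p) * (1 - s) powr (-1))"
      using g0 l s1 by (simp add: powr_divide powr_minus powr_neg_one field_simps)
    also have "l s powr (- p) = (\<eta> / 4) powr (- p) * (1 - r) powr (\<eta> * p) * (1 - s) powr (p - \<eta> * p)"
    proof -
      have "l s powr (- p) = (\<eta> / 4) powr (- p) * ((1 - r) powr (- \<eta>)) powr (- p) * ((1 - s) powr (\<eta> - 1)) powr (- p)"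
        using s1 \<eta> by (simp only: l_def powr_mult)
      then show ?thesis by (simp add: powr_powr algebra_simps)
    qed
    also have "(\<eta> / 4) powr (- p) * (1 - r) powr (\<eta> * p) * (1 - s) powr (p - \<eta> * p) * (1 - s) powr (-1)
        = hardy_const p \<kappa> * (1 - r) powr (\<kappa> / 2) * (1 - s) powr (p - \<kappa> / 2 - 1)"
      by (simp only: K \<eta> mult.assoc powr_add[symmetric] add_uminus_conv_diff)
    finally have "(g s / l s) powr p / (1 - s) = w s"
      by (simp add: w_def mult_ac)
    moreover have "g s \<le> l s + (g s / l s) powr p / (1 - s)"
      by (rule young_split) (use g0 l s1 p gle[of s] s r in auto)
    ultimately show ?thesis by simp
  qed
  have l0: "0 \<le> l s" and w0: "0 \<le> w s" for s
    using \<eta> K0 by (auto simp: l_def w_def)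
  have [measurable]: "l \<in> borel_measurable borel" "w \<in> borel_measurable borel"
    by (auto simp: l_def w_def)
  have "(\<integral>\<^sup>+s\<in>{r..R}. ennreal (g s) \<partial>lborel)
      \<le> (\<integral>\<^sup>+s. ennreal (l s) * indicator {r..R} s + ennreal (w s) * indicator {r..R} s \<partial>lborel)"
    using split l0 w0 by (intro nn_integral_mono) (auto simp: indicator_def simp flip: ennreal_plus intro!: ennreal_leI)
  also have "\<dots> = (\<integral>\<^sup>+s\<in>{r..R}. ennreal (l s) \<partial>lborel) + (\<integral>\<^sup>+s\<in>{r..R}. ennreal (w s) \<partial>lborel)"
    by (rule nn_integral_add) auto
  also have "(\<integral>\<^sup>+s\<in>{r..R}. ennreal (l s) \<partial>lborel)
      = ennreal (\<eta> / 4 * (1 - r) powr (- \<eta>)) * (\<integral>\<^sup>+s\<in>{r..R}. ennreal ((1 - s) powr (\<eta> - 1)) \<partial>lborel)"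
  proof -
    have "ennreal (l s) = ennreal (\<eta> / 4 * (1 - r) powr (- \<eta>)) * ennreal ((1 - s) powr (\<eta> - 1))" for s
      unfolding l_def by (rule ennreal_mult) (use \<eta> in auto)
    then show ?thesis
      by (simp only: mult.assoc) (rule nn_integral_cmult, measurable)
  qed
  also have "\<dots> \<le> ennreal (\<eta> / 4 * (1 - r) powr (- \<eta>)) * ennreal ((1 - r) powr \<eta> / \<eta>)"
    by (intro mult_left_mono nn_integral_powr_boundary_le) (use r \<eta> in auto)
  also have "\<dots> = ennreal (1 / 4)"
    using \<eta> r by (subst ennreal_mult[symmetric]) (auto simp: powr_minus field_simps)
  also have "(\<integral>\<^sup>+s\<in>{r..R}. ennreal (w s) \<partial>lborel) = ennreal (hardy_const p \<kappa> * (1 - r) powr (\<kappa> / 2)) *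
      (\<integral>\<^sup>+s\<in>{r..R}. ennreal (g s powr p * (1 - s) powr (p - \<kappa> / 2 - 1)) \<partial>lborel)"
    using K0 by (subst nn_integral_cmult[symmetric]) (auto simp: w_def ennreal_mult mult.assoc)
  finally show ?thesis by (simp add: add_mono)
qed

lemma ennreal_absorb_quarter:
  fixes A X :: ennreal
  assumes "ennreal (1 / 2) \<le> A + (ennreal (1 / 4) + X)"
  shows "1 \<le> 4 * A + 4 * X"
proof (cases A; cases X)
  fix u v :: real assume uv: "0 \<le> u" "A = ennreal u" "0 \<le> v" "X = ennreal v"
  have "ennreal (1 / 2) \<le> ennreal (u + (1 / 4 + v))"
    using assms uv by (simp only: ennreal_plus)
  then have "1 / 2 \<le> u + (1 / 4 + v)"
    using uv by (subst (asm) ennreal_le_iff) auto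
  then have "ennreal 1 \<le> ennreal (4 * u + 4 * v)"
    by (intro ennreal_leI) simp
  then show ?thesis
    using uv by (simp add: ennreal_mult)
qed (auto simp: ennreal_mult_eq_top_iff ennreal_mult_top)

text \<open>
  In the application \<open>g\<close> is \<open>|B'|\<close> along a ray, \<open>\<phi>\<close> is the defect \<open>1 - |B|\<close> where the ray
  is cut off, and \<open>E\<close> is the set of radii at which the ray runs through a box.  By \<open>radial_integral_split\<close> the
  lower bound 1/2 survives as a lower bound 1/4 for \<open>\<phi>\<close> plus a weighted
  integral of \<open>g\<^sup>p\<close>.  Multiplying by \<open>(1 - r)\<^bsup>-\<kappa>-1\<^esup>\<close> and exchanging the integrals, the
  integral of \<open>(1 - r)\<^bsup>-\<kappa>/2-1\<^esup>\<close> over \<open>r \<le> s\<close> supplies the missing factor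
  \<open>(1 - s)\<^bsup>-\<kappa>/2\<^esup>\<close>.
\<close>

lemma radial_hardy_inequality:
  fixes g :: "real \<Rightarrow> real"
  assumes [measurable]: "g \<in> borel_measurable borel" and g0: "\<And>s. 0 \<le> g s"
    and gle: "\<And>s. 0 < s \<Longrightarrow> s < 1 \<Longrightarrow> g s \<le> 1 / (1 - s)"
    and \<kappa>: "0 < \<kappa>" "\<kappa> < p" and R: "r0 \<le> R" "R < 1"
    and E [measurable]: "E \<in> sets borel" and Esub: "E \<subseteq> {1/2..r0}" and \<phi>: "0 \<le> \<phi>"
    and big: "\<And>r. r \<in> E \<Longrightarrow> ennreal (1/2) \<le> ennreal \<phi> + (\<integral>\<^sup>+s\<in>{r..R}. ennreal (g s) \<partial>lborel)"
  shows "(\<integral>\<^sup>+r\<in>E. ennreal ((1 - r) powr (- \<kappa> - 1)) \<partial>lborel)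
    \<le> ennreal (4 * (1 - r0) powr (- \<kappa> - 1) * \<phi>)
      + ennreal (8 * hardy_const p \<kappa> / \<kappa>) *
        (\<integral>\<^sup>+s\<in>{1/2..<1}. ennreal (g s powr p * (1 - s) powr (p - 1 - \<kappa>)) \<partial>lborel)"
proof -
  define K where "K = hardy_const p \<kappa>"
  have K0: "0 \<le> K" by (simp add: K_def hardy_const_def)
  define w where "w = (\<lambda>s. g s powr p * (1 - s) powr (p - \<kappa> / 2 - 1))"
  have w0: "0 \<le> w s" for s by (simp add: w_def)
  have [measurable]: "w \<in> borel_measurable borel" by (simp add: w_def)
  have pt: "ennreal ((1 - r) powr (- \<kappa> - 1)) * indicator E r \<le>
      ennreal (4 * (1 - r0) powr (- \<kappa> - 1) * \<phi>) * indicator {0..1} r +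
      (\<integral>\<^sup>+s. ennreal (4 * K * (1 - r) powr (- (\<kappa> / 2) - 1)) * (ennreal (w s) * indicator {s. 1/2 \<le> r \<and> r \<le> s \<and> s \<le> R} s) \<partial>lborel)"
    for r
  proof (cases "r \<in> E")
    case True
    then have r: "1/2 \<le> r" "r \<le> r0" "r < 1" using Esub R by auto
    let ?W = "\<integral>\<^sup>+s\<in>{r..R}. ennreal (w s) \<partial>lborel"
    have "ennreal (1 / 2) \<le> ennreal \<phi> + (ennreal (1 / 4) + ennreal (K * (1 - r) powr (\<kappa> / 2)) * ?W)"
      unfolding w_def K_def
      by (rule order_trans[OF big[OF True]], rule add_left_mono, rule radial_integral_split)
         (use g0 gle \<kappa> r R in auto)
    from ennreal_absorb_quarter[OF this]
    have "ennreal ((1 - r) powr (- \<kappa> - 1)) * 1 \<le> ennreal ((1 - r) powr (- \<kappa> - 1)) *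
        (4 * ennreal \<phi> + 4 * (ennreal (K * (1 - r) powr (\<kappa> / 2)) * ?W))"
      by (intro mult_left_mono) auto
    also have "\<dots> = ennreal (4 * (1 - r) powr (- \<kappa> - 1) * \<phi>)
        + ennreal (4 * K * ((1 - r) powr (- \<kappa> - 1) * (1 - r) powr (\<kappa> / 2))) * ?W"
      using \<phi> K0 by (simp add: ennreal_mult distrib_left mult_ac)
    also have "(1 - r) powr (- \<kappa> - 1) * (1 - r) powr (\<kappa> / 2) = (1 - r) powr (- (\<kappa> / 2) - 1)"
      by (simp flip: powr_add)
    also have "ennreal (4 * (1 - r) powr (- \<kappa> - 1) * \<phi>) \<le> ennreal (4 * (1 - r0) powr (- \<kappa> - 1) * \<phi>)"
      using r R \<kappa> \<phi> by (intro ennreal_leI mult_right_mono mult_left_mono powr_mono2') auto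
    also have "ennreal (4 * K * (1 - r) powr (- (\<kappa> / 2) - 1)) * ?W
        = (\<integral>\<^sup>+s. ennreal (4 * K * (1 - r) powr (- (\<kappa> / 2) - 1)) * (ennreal (w s) * indicator {s. 1/2 \<le> r \<and> r \<le> s \<and> s \<le> R} s) \<partial>lborel)"
      using r by (subst nn_integral_cmult[symmetric]) (auto intro!: nn_integral_cong simp: indicator_def)
    finally show ?thesis using True r by (simp add: add_mono)
  qed simp
  have "(\<integral>\<^sup>+r\<in>E. ennreal ((1 - r) powr (- \<kappa> - 1)) \<partial>lborel) \<le>
    (\<integral>\<^sup>+r. ennreal (4 * (1 - r0) powr (- \<kappa> - 1) * \<phi>) * indicator {0..1} r +
      (\<integral>\<^sup>+s. ennreal (4 * K * (1 - r) powr (- (\<kappa> / 2) - 1)) * (ennreal (w s) * indicator {s. 1/2 \<le> r \<and> r \<le> s \<and> s \<le> R} s) \<partial>lborel) \<partial>lborel)"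
    by (intro nn_integral_mono pt)
  also have "\<dots> = ennreal (4 * (1 - r0) powr (- \<kappa> - 1) * \<phi>) +
    (\<integral>\<^sup>+r. \<integral>\<^sup>+s. ennreal (4 * K * (1 - r) powr (- (\<kappa> / 2) - 1)) * (ennreal (w s) * indicator {s. 1/2 \<le> r \<and> r \<le> s \<and> s \<le> R} s) \<partial>lborel \<partial>lborel)"
    by (subst nn_integral_add) (auto simp: nn_integral_cmult_indicator)
  also have "(\<integral>\<^sup>+r. \<integral>\<^sup>+s. ennreal (4 * K * (1 - r) powr (- (\<kappa> / 2) - 1)) * (ennreal (w s) * indicator {s. 1/2 \<le> r \<and> r \<le> s \<and> s \<le> R} s) \<partial>lborel \<partial>lborel)
     = (\<integral>\<^sup>+s. \<integral>\<^sup>+r. ennreal (4 * K * (1 - r) powr (- (\<kappa> / 2) - 1)) * (ennreal (w s) * indicator {s. 1/2 \<le> r \<and> r \<le> s \<and> s \<le> R} s) \<partial>lborel \<partial>lborel)"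
    by (rule lborel_pair.Fubini') (simp add: indicator_def)
  also have "\<dots> \<le> (\<integral>\<^sup>+s. ennreal (8 * K / \<kappa>) * (ennreal (g s powr p * (1 - s) powr (p - 1 - \<kappa>)) * indicator {1/2..<1} s) \<partial>lborel)"
  proof (rule nn_integral_mono)
    fix s :: real
    show "(\<integral>\<^sup>+r. ennreal (4 * K * (1 - r) powr (- (\<kappa> / 2) - 1)) * (ennreal (w s) * indicator {s. 1/2 \<le> r \<and> r \<le> s \<and> s \<le> R} s) \<partial>lborel)
      \<le> ennreal (8 * K / \<kappa>) * (ennreal (g s powr p * (1 - s) powr (p - 1 - \<kappa>)) * indicator {1/2..<1} s)"
    proof (cases "1/2 \<le> s \<and> s \<le> R")
      case True
      then have s: "s < 1" using R by simp
      have "(\<integral>\<^sup>+r. ennreal (4 * K * (1 - r) powr (- (\<kappa> / 2) - 1)) * (ennreal (w s) * indicator {s. 1/2 \<le> r \<and> r \<le> s \<and> s \<le> R} s) \<partial>lborel)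
         = (\<integral>\<^sup>+r. ennreal (4 * K) * ennreal (w s) * (ennreal ((1 - r) powr (- (\<kappa> / 2) - 1)) * indicator {1/2..s} r) \<partial>lborel)"
        using True K0 by (intro nn_integral_cong) (auto simp: indicator_def ennreal_mult mult_ac)
      also have "\<dots> = ennreal (4 * K) * ennreal (w s) * (\<integral>\<^sup>+r\<in>{1/2..s}. ennreal ((1 - r) powr (- (\<kappa> / 2) - 1)) \<partial>lborel)"
        by (rule nn_integral_cmult) measurable
      also have "\<dots> \<le> ennreal (4 * K) * ennreal (w s) * ennreal ((1 - s) powr (- (\<kappa> / 2)) / (\<kappa> / 2))"
        by (intro mult_left_mono nn_integral_powr_boundary_neg_le) (use True s \<kappa> in auto)
      also have "\<dots> = ennreal (8 * K / \<kappa> * (g s powr p * ((1 - s) powr (p - \<kappa> / 2 - 1) * (1 - s) powr (- (\<kappa> / 2)))))"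
        using K0 \<kappa> w0 by (simp add: w_def ennreal_mult[symmetric] mult_ac)
      also have "(1 - s) powr (p - \<kappa> / 2 - 1) * (1 - s) powr (- (\<kappa> / 2)) = (1 - s) powr (p - 1 - \<kappa>)"
        by (simp add: algebra_simps flip: powr_add)
      finally show ?thesis
        using True s K0 \<kappa> by (subst (asm) ennreal_mult) auto
    next
      case False
      then have "indicator {s. 1/2 \<le> r \<and> r \<le> s \<and> s \<le> R} s = (0::ennreal)" for r
        by (auto simp: indicator_def)
      then show ?thesis by simp
    qed
  qed
  also have "\<dots> = ennreal (8 * K / \<kappa>) *
        (\<integral>\<^sup>+s\<in>{1/2..<1}. ennreal (g s powr p * (1 - s) powr (p - 1 - \<kappa>)) \<partial>lborel)"
    by (rule nn_integral_cmult) measurable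
  finally show ?thesis by (simp add: K_def add_mono)
qed

section \<open>A Hardy inequality in the disc\<close>

lemma norm_increment_le_radial_integral:
  assumes hol: "f holomorphic_on ball 0 1" and r: "0 \<le> r" "r \<le> R" "R < 1"
  shows "ennreal (norm (f (of_real R * cis t)) - norm (f (of_real r * cis t)))
    \<le> (\<integral>\<^sup>+s\<in>{r..R}. ennreal (norm (deriv f (of_real s * cis t))) \<partial>lborel)"
proof -
  have inb: "of_real s * cis t \<in> ball 0 1" if "s \<in> {r..R}" for s
    using that r by (simp add: norm_mult)
  have cont: "continuous_on {r..R} (\<lambda>s. deriv f (of_real s * cis t))"
    by (rule continuous_on_compose2[OF holomorphic_on_imp_continuous_on[OF holomorphic_deriv[OF hol]]])
       (use inb in \<open>auto intro!: continuous_intros\<close>)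
  have "((\<lambda>s. cis t * deriv f (of_real s * cis t)) has_integral
      f (of_real R * cis t) - f (of_real r * cis t)) {r..R}"
  proof (rule fundamental_theorem_of_calculus[OF r(2)])
    fix s assume s: "s \<in> {r..R}"
    have "(f has_field_derivative deriv f (of_real s * cis t)) (at (of_real s * cis t))"
      by (rule holomorphic_derivI[OF hol _ inb[OF s]]) simp
    moreover have "((\<lambda>s. of_real s * cis t) has_vector_derivative cis t) (at s within {r..R})"
      by (auto intro!: derivative_eq_intros has_vector_derivative_real_field)
    ultimately have "(f \<circ> (\<lambda>s. of_real s * cis t) has_vector_derivative
        cis t * deriv f (of_real s * cis t)) (at s within {r..R})"
      by (intro field_vector_diff_chain_within) (auto intro: has_field_derivative_at_within)
    then show "((\<lambda>s. f (of_real s * cis t)) has_vector_derivative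
        cis t * deriv f (of_real s * cis t)) (at s within {r..R})"
      by (simp add: o_def)
  qed
  then have incr: "f (of_real R * cis t) - f (of_real r * cis t)
      = integral {r..R} (\<lambda>s. cis t * deriv f (of_real s * cis t))"
    by (rule integral_unique[symmetric])
  have "norm (f (of_real R * cis t) - f (of_real r * cis t))
      = norm (integral {r..R} (\<lambda>s. cis t * deriv f (of_real s * cis t)))"
    by (simp only: incr)
  also have " \<dots> \<le> integral {r..R} (\<lambda>s. norm (deriv f (of_real s * cis t)))"
    by (intro integral_norm_bound_integral integrable_continuous_interval continuous_intros cont)
       (simp add: norm_mult)
  finally have "norm (f (of_real R * cis t)) - norm (f (of_real r * cis t))
      \<le> integral {r..R} (\<lambda>s. norm (deriv f (of_real s * cis t)))"
    using norm_triangle_ineq2 order_trans by blast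
  then have "ennreal (norm (f (of_real R * cis t)) - norm (f (of_real r * cis t)))
      \<le> ennreal (integral {r..R} (\<lambda>s. norm (deriv f (of_real s * cis t))))"
    by (rule ennreal_leI)
  also have "\<dots> = (\<integral>\<^sup>+s\<in>{r..R}. ennreal (norm (deriv f (of_real s * cis t))) \<partial>lborel)"
    by (rule nn_integral_continuous_Icc[symmetric]) (auto intro!: continuous_intros cont)
  finally show ?thesis .
qed

lemma ennreal_add_le_add_ennreal: "ennreal (x + y) \<le> ennreal x + ennreal y"
proof (cases "0 \<le> x \<and> 0 \<le> y")
  case False
  then have "ennreal (x + y) \<le> ennreal x \<or> ennreal (x + y) \<le> ennreal y"
    by (auto intro!: ennreal_leI)
  then show ?thesis by (auto intro: order_trans)
qed simp

text \<open>
  Integrate \<open>radial_hardy_inequality\<close> over the angle, with rays cut off at radius \<open>R\<close>.  The term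
  with \<open>1 - |f|\<close> on that circle carries a factor which depends on \<open>r0\<close> only, so
  it can be made as small as desired by the choice of \<open>R\<close>.  Radii are at least 1/2 on the set \<open>E\<close>, so
  that the factor \<open>r\<close> of the polar area element costs only a factor 2.
\<close>

lemma disc_hardy_inequality:
  fixes f :: "complex \<Rightarrow> complex" and E :: "(real \<times> real) set"
  assumes hol: "f holomorphic_on ball 0 1" and le1: "\<And>z. norm z < 1 \<Longrightarrow> norm (f z) \<le> 1"
    and means: "\<And>e \<rho>. 0 < e \<Longrightarrow> \<rho> < 1 \<Longrightarrow> \<exists>R>\<rho>. 0 < R \<and> R < 1 \<and>
      integral {0..2 * pi} (\<lambda>t. 1 - norm (f (of_real R * cis t))) \<le> e"
    and \<kappa>: "0 < \<kappa>" "\<kappa> < p"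
    and E [measurable]: "E \<in> sets borel" and Esub: "E \<subseteq> {1/2..r0} \<times> {0..2*pi}" and r0: "r0 < 1"
    and small: "\<And>r t. (r, t) \<in> E \<Longrightarrow> norm (f (of_real r * cis t)) \<le> 1/2"
  shows "(\<integral>\<^sup>+t. \<integral>\<^sup>+r. ennreal ((1 - r) powr (- \<kappa> - 1)) * indicator E (r, t) \<partial>lborel \<partial>lborel)
    \<le> ennreal (80 * hardy_const p \<kappa> / \<kappa>) *
      (\<integral>\<^sup>+z\<in>ball 0 1. ennreal (norm (deriv f z) powr p * (1 - norm z) powr (p - 1 - \<kappa>)) \<partial>lborel)"
    (is "?L \<le> ?C * ?I")
proof (rule ennreal_le_epsilon)
  fix e :: real assume e: "0 < e"
  define W where "W = 4 * (1 - r0) powr (- \<kappa> - 1)"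
  have W: "0 < W" using r0 by (simp add: W_def)
  obtain R where R: "r0 < R" "0 < R" "R < 1"
    and mean: "integral {0..2 * pi} (\<lambda>t. 1 - norm (f (of_real R * cis t))) \<le> e / W"
    using means[of "e / W" r0] e W r0 by auto
  \<comment> \<open>Outside the disc \<open>deriv f\<close> is arbitrary, so \<open>b\<close> is cut off there to be Borel measurable.\<close>
  define b where "b = (\<lambda>z. if z \<in> ball 0 1 then norm (deriv f z) else 0)"
  have b0: "0 \<le> b z" for z by (simp add: b_def)
  have "(\<lambda>z. indicator (ball 0 1) z *\<^sub>R norm (deriv f z)) \<in> borel_measurable borel"
    by (intro borel_measurable_continuous_on_indicator continuous_intros
        holomorphic_on_imp_continuous_on holomorphic_deriv hol) auto
  also have "(\<lambda>z. indicator (ball 0 1) z *\<^sub>R norm (deriv f z)) = b"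
    by (auto simp: b_def indicator_def fun_eq_iff)
  finally have [measurable]: "b \<in> borel_measurable borel" .
  define \<phi> where "\<phi> = (\<lambda>t. 1 - norm (f (of_real R * cis t)))"
  have \<phi>0: "0 \<le> \<phi> t" for t
    using le1[of "of_real R * cis t"] R by (simp add: \<phi>_def norm_mult)
  have cont\<phi>: "continuous_on A \<phi>" for A
    unfolding \<phi>_def
    by (intro continuous_intros continuous_on_compose2[OF holomorphic_on_imp_continuous_on[OF hol]])
       (use R in \<open>auto simp: norm_mult\<close>)
  have [measurable]: "\<phi> \<in> borel_measurable borel"
    by (intro borel_measurable_continuous_onI cont\<phi>)
  define F where "F = (\<lambda>t. \<integral>\<^sup>+s\<in>{1/2..<1}. ennreal (b (of_real s * cis t) powr p * (1 - s) powr (p - 1 - \<kappa>)) \<partial>lborel)"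
  have [measurable]: "F \<in> borel_measurable borel"
    unfolding F_def by measurable
  have Kc: "0 \<le> 8 * hardy_const p \<kappa> / \<kappa>"
    using \<kappa> by (simp add: hardy_const_def)
  have radial: "(\<integral>\<^sup>+r. ennreal ((1 - r) powr (- \<kappa> - 1)) * indicator E (r, t) \<partial>lborel)
      \<le> ennreal (W * \<phi> t) * indicator {0..2*pi} t + ennreal (8 * hardy_const p \<kappa> / \<kappa>) * (F t * indicator {0..2*pi} t)"
    for t
  proof (cases "t \<in> {0..2*pi}")
    case True
    define Et where "Et = {r. (r, t) \<in> E}"
    have "(\<integral>\<^sup>+r\<in>Et. ennreal ((1 - r) powr (- \<kappa> - 1)) \<partial>lborel)
      \<le> ennreal (4 * (1 - r0) powr (- \<kappa> - 1) * \<phi> t) + ennreal (8 * hardy_const p \<kappa> / \<kappa>) * F t"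
      unfolding F_def
    proof (rule radial_hardy_inequality[where R = R])
      show "Et \<in> sets borel" unfolding Et_def by measurable
      show "b (of_real s * cis t) \<le> 1 / (1 - s)" if "0 < s" "s < 1" for s
        using norm_deriv_le_inverse_boundary_distance[OF hol le1, of "of_real s * cis t"] that
        by (simp add: b_def norm_mult)
      fix r assume "r \<in> Et"
      then have rE: "(r, t) \<in> E" and r: "1/2 \<le> r" "r \<le> r0" using Esub by (auto simp: Et_def)
      have "ennreal (1/2) \<le> ennreal (\<phi> t + (norm (f (of_real R * cis t)) - norm (f (of_real r * cis t))))"
        using small[OF rE] by (intro ennreal_leI) (simp add: \<phi>_def)
      also have "\<dots> \<le> ennreal (\<phi> t) + ennreal (norm (f (of_real R * cis t)) - norm (f (of_real r * cis t)))"
        by (rule ennreal_add_le_add_ennreal)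
      also have "ennreal (norm (f (of_real R * cis t)) - norm (f (of_real r * cis t)))
          \<le> (\<integral>\<^sup>+s\<in>{r..R}. ennreal (norm (deriv f (of_real s * cis t))) \<partial>lborel)"
        by (rule norm_increment_le_radial_integral[OF hol]) (use r R in auto)
      also have "\<dots> = (\<integral>\<^sup>+s\<in>{r..R}. ennreal (b (of_real s * cis t)) \<partial>lborel)"
        by (intro nn_integral_cong) (use r R in \<open>auto simp: b_def indicator_def norm_mult\<close>)
      finally show "ennreal (1/2) \<le> ennreal (\<phi> t) + (\<integral>\<^sup>+s\<in>{r..R}. ennreal (b (of_real s * cis t)) \<partial>lborel)"
        by (simp add: add_left_mono)
    qed (use b0 \<kappa> R Esub \<phi>0 in \<open>auto simp: Et_def\<close>)
    moreover have "(\<integral>\<^sup>+r\<in>Et. ennreal ((1 - r) powr (- \<kappa> - 1)) \<partial>lborel)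
        = (\<integral>\<^sup>+r. ennreal ((1 - r) powr (- \<kappa> - 1)) * indicator E (r, t) \<partial>lborel)"
      by (intro nn_integral_cong) (auto simp: Et_def indicator_def)
    ultimately show ?thesis
      using True by (simp add: W_def)
  next
    case False
    then have "indicator E (r, t) = (0::ennreal)" for r using Esub by (auto simp: indicator_def)
    then show ?thesis by simp
  qed
  have "?L \<le> (\<integral>\<^sup>+t. ennreal (W * \<phi> t) * indicator {0..2*pi} t
      + ennreal (8 * hardy_const p \<kappa> / \<kappa>) * (F t * indicator {0..2*pi} t) \<partial>lborel)"
    by (intro nn_integral_mono radial)
  also have "\<dots> = (\<integral>\<^sup>+t\<in>{0..2*pi}. ennreal (W * \<phi> t) \<partial>lborel)
      + ennreal (8 * hardy_const p \<kappa> / \<kappa>) * (\<integral>\<^sup>+t\<in>{0..2*pi}. F t \<partial>lborel)"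
    by (simp add: nn_integral_add nn_integral_cmult)
  also have "(\<integral>\<^sup>+t\<in>{0..2*pi}. ennreal (W * \<phi> t) \<partial>lborel) = ennreal (integral {0..2*pi} (\<lambda>t. W * \<phi> t))"
    by (rule nn_integral_continuous_Icc) (use W \<phi>0 cont\<phi> in \<open>auto intro!: continuous_intros\<close>)
  also have "\<dots> \<le> ennreal e"
  proof -
    have "integral {0..2*pi} (\<lambda>t. W * \<phi> t) = W * integral {0..2*pi} \<phi>"
      by (rule integral_mult_right)
    also have "\<dots> \<le> W * (e / W)"
      using mean W unfolding \<phi>_def by (intro mult_left_mono) auto
    finally show ?thesis using W by (intro ennreal_leI) simp
  qed
  also have "(\<integral>\<^sup>+t\<in>{0..2*pi}. F t \<partial>lborel) \<le> 10 * ?I"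
  proof -
    \<comment> \<open>The factor 2 makes up for \<open>s \<ge> 1/2\<close> in the polar area element \<open>s ds dt\<close>.\<close>
    define g where "g = (\<lambda>z. 2 * (b z powr p * (1 - norm z) powr (p - 1 - \<kappa>)))"
    have g0: "0 \<le> g z" for z by (simp add: g_def)
    have [measurable]: "g \<in> borel_measurable borel" by (simp add: g_def)
    have "F t \<le> (\<integral>\<^sup>+s\<in>{0<..}. ennreal (s * g (of_real s * cis t)) \<partial>lborel)" for t
      unfolding F_def
    proof (intro nn_integral_mono)
      fix s :: real
      have "b (of_real s * cis t) powr p * (1 - s) powr (p - 1 - \<kappa>) \<le> s * g (of_real s * cis t)"
        if "1/2 \<le> s"
        using that mult_right_mono[of 1 "s * 2" "b (of_real s * cis t) powr p * (1 - s) powr (p - 1 - \<kappa>)"]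
        by (simp add: g_def norm_mult mult_ac)
      then show "ennreal (b (of_real s * cis t) powr p * (1 - s) powr (p - 1 - \<kappa>)) * indicator {1/2..<1} s
        \<le> ennreal (s * g (of_real s * cis t)) * indicator {0<..} s"
        by (auto simp: indicator_def intro!: ennreal_leI)
    qed
    then have "(\<integral>\<^sup>+t\<in>{0..2*pi}. F t \<partial>lborel)
        \<le> (\<integral>\<^sup>+t\<in>{0..2*pi}. (\<integral>\<^sup>+s\<in>{0<..}. ennreal (s * g (of_real s * cis t)) \<partial>lborel) \<partial>lborel)"
      by (intro nn_integral_mono mult_right_mono) auto
    also have "\<dots> \<le> 5 * (\<integral>\<^sup>+z. ennreal (g z) \<partial>lborel)"
      by (rule nn_integral_polar_le) (use g0 in auto)
    also have "(\<integral>\<^sup>+z. ennreal (g z) \<partial>lborel) = (\<integral>\<^sup>+z. 2 * ennreal (b z powr p * (1 - norm z) powr (p - 1 - \<kappa>)) \<partial>lborel)"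
      by (simp add: g_def ennreal_mult)
    also have "\<dots> = 2 * (\<integral>\<^sup>+z. ennreal (b z powr p * (1 - norm z) powr (p - 1 - \<kappa>)) \<partial>lborel)"
      by (rule nn_integral_cmult) measurable
    also have "(\<integral>\<^sup>+z. ennreal (b z powr p * (1 - norm z) powr (p - 1 - \<kappa>)) \<partial>lborel) = ?I"
      by (intro nn_integral_cong) (auto simp: b_def indicator_def)
    also have "5 * (2 * ?I) = 10 * ?I"
      by (simp flip: mult.assoc)
    finally show ?thesis .
  qed
  also have "ennreal (8 * hardy_const p \<kappa> / \<kappa>) * (10 * ?I) = ?C * ?I"
  proof -
    have "?C = ennreal (8 * hardy_const p \<kappa> / \<kappa>) * ennreal 10"
      using Kc by (subst ennreal_mult[symmetric]) auto
    then show ?thesis by (simp add: mult_ac)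
  qed
  finally show "?L \<le> ?C * ?I + ennreal e"
    by (simp add: add.commute add_mono mult_left_mono)
qed

lemma nn_integral_interval_powr_ge:
  fixes r h \<kappa> :: real
  assumes "r < 1" "0 < \<kappa>" "0 \<le> h" "h \<le> 1 - r"
  shows "ennreal (h * (2 * (1 - r)) powr (- \<kappa> - 1)) \<le> (\<integral>\<^sup>+s\<in>{r - h..r}. ennreal ((1 - s) powr (- \<kappa> - 1)) \<partial>lborel)"
proof -
  have "ennreal (h * (2 * (1 - r)) powr (- \<kappa> - 1)) = (\<integral>\<^sup>+s\<in>{r - h..r}. ennreal ((2 * (1 - r)) powr (- \<kappa> - 1)) \<partial>lborel)"
    using assms by (simp add: nn_integral_cmult_indicator ennreal_mult mult.commute[of "ennreal h"])
  also have "\<dots> \<le> (\<integral>\<^sup>+s\<in>{r - h..r}. ennreal ((1 - s) powr (- \<kappa> - 1)) \<partial>lborel)"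
    by (intro nn_integral_mono) (use assms in \<open>auto simp: indicator_def intro!: ennreal_leI powr_mono2'\<close>)
  finally show ?thesis .
qed

lemma norm_polar_diff_le:
  assumes "0 \<le> r" "r \<le> 1"
  shows "norm (of_real r * cis t - of_real q * cis u) \<le> \<bar>t - u\<bar> + \<bar>r - q\<bar>"
proof -
  have "of_real r * cis t - of_real q * cis u = of_real r * (cis t - cis u) + of_real (r - q) * cis u"
    by (simp add: algebra_simps)
  also have "norm \<dots> \<le> r * norm (cis t - cis u) + \<bar>r - q\<bar>"
    using assms by (intro order_trans[OF norm_triangle_ineq]) (simp add: norm_mult del: of_real_diff)
  also have "r * norm (cis t - cis u) \<le> 1 * norm (cis t - cis u)"
    using assms by (intro mult_right_mono) auto
  also have "norm (cis t - cis u) \<le> \<bar>t - u\<bar>"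
  proof -
    have "norm (cis t - cis u) = norm (cis u * (cis (t - u) - 1))"
      by (simp add: right_diff_distrib cis_mult)
    also have "\<dots> = norm (exp (\<i> * of_real (t - u)) - 1)"
      by (simp add: norm_mult cis_conv_exp)
    also have "\<dots> \<le> \<bar>t - u\<bar>"
      using abs_sin_x_le_abs_x[of "(t - u) / 2"] by (simp only: dist_exp_i_1) simp
    finally show ?thesis .
  qed
  finally show ?thesis by simp
qed

section \<open>Boxes at the zeros\<close>

text \<open>
  The box with outer radius \<open>|w|\<close> and side \<open>\<epsilon> (1 - |w|)\<close> that has \<open>w\<close> as a corner.  The side on which it
  extends in the angle is chosen to keep the angles inside \<open>[0, 2\<pi>]\<close>, so that no
  box wraps around.
\<close>

definition polar_box :: "real \<Rightarrow> complex \<Rightarrow> (real \<times> real) set" where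
  "polar_box \<epsilon> w = (let h = \<epsilon> * (1 - norm w); l = (if Arg2pi w \<le> pi then Arg2pi w else Arg2pi w - h)
     in {norm w - h..norm w} \<times> {l..l + h})"

lemma polar_box_properties:
  assumes \<epsilon>: "0 \<le> \<epsilon>" "\<epsilon> \<le> 1/4" and w: "3/4 \<le> norm w" "norm w < 1" and rt: "(r, t) \<in> polar_box \<epsilon> w"
  shows "1/2 \<le> r" "r \<le> norm w" "0 \<le> t" "t \<le> 2 * pi"
    and "norm (of_real r * cis t - w) \<le> 2 * \<epsilon> * (1 - norm w)"
proof -
  define h where "h = \<epsilon> * (1 - norm w)"
  have "h \<le> 1/4 * (1/4)"
    unfolding h_def by (intro mult_mono) (use \<epsilon> w in auto)
  then have h: "0 \<le> h" "h \<le> 1/4"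
    using \<epsilon> w by (auto simp: h_def)
  have Arg: "0 \<le> Arg2pi w" "Arg2pi w < 2 * pi" "w = of_real (norm w) * cis (Arg2pi w)"
    using Arg2pi[of w] by (auto simp: is_Arg_def cis_conv_exp)
  have rt': "norm w - h \<le> r" "r \<le> norm w" "\<bar>t - Arg2pi w\<bar> \<le> h" "0 \<le> t" "t \<le> 2 * pi"
    using rt Arg(1,2) h pi_gt3 by (auto simp: polar_box_def Let_def simp flip: h_def split: if_splits)
  then show "1/2 \<le> r" "r \<le> norm w" "0 \<le> t" "t \<le> 2 * pi"
    using h w by auto
  have "norm (of_real r * cis t - w) = norm (of_real r * cis t - of_real (norm w) * cis (Arg2pi w))"
    using Arg(3) by simp
  also have "\<dots> \<le> \<bar>t - Arg2pi w\<bar> + \<bar>r - norm w\<bar>"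
    by (rule norm_polar_diff_le) (use rt' h w in auto)
  also have "\<dots> \<le> 2 * h" using rt' by auto
  finally show "norm (of_real r * cis t - w) \<le> 2 * \<epsilon> * (1 - norm w)"
    by (simp add: h_def)
qed

text \<open>
  The box has sides \<open>\<epsilon> (1 - |w|)\<close>, and \<open>1 - r \<le> 2 (1 - |w|)\<close> on it.
\<close>

lemma polar_box_weight_ge:
  assumes "0 < \<epsilon>" "\<epsilon> \<le> 1" "norm w < 1" "0 < \<kappa>"
  shows "ennreal (\<epsilon>\<^sup>2 * 2 powr (- \<kappa> - 1) * (1 - norm w) powr (1 - \<kappa>))
    \<le> (\<integral>\<^sup>+t. \<integral>\<^sup>+r. ennreal ((1 - r) powr (- \<kappa> - 1)) * indicator (polar_box \<epsilon> w) (r, t) \<partial>lborel \<partial>lborel)"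
proof -
  define d where "d = 1 - norm w"
  define h where "h = \<epsilon> * d"
  define l where "l = (if Arg2pi w \<le> pi then Arg2pi w else Arg2pi w - h)"
  have d: "0 < d" using assms by (simp add: d_def)
  have h: "0 \<le> h" "h \<le> d"
    using assms d mult_right_mono[of \<epsilon> 1 d] by (auto simp: h_def)
  have box: "polar_box \<epsilon> w = {norm w - h..norm w} \<times> {l..l + h}"
    by (simp add: polar_box_def Let_def l_def h_def d_def)
  have "d powr (1 - \<kappa>) = d\<^sup>2 * d powr (- \<kappa> - 1)"
    using d by (simp flip: powr_numeral powr_add)
  then have "\<epsilon>\<^sup>2 * 2 powr (- \<kappa> - 1) * d powr (1 - \<kappa>) = h * (h * (2 * d) powr (- \<kappa> - 1))"
    using d by (simp add: h_def powr_mult power2_eq_square mult_ac)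
  then have "ennreal (\<epsilon>\<^sup>2 * 2 powr (- \<kappa> - 1) * d powr (1 - \<kappa>)) = ennreal (h * (2 * d) powr (- \<kappa> - 1)) * ennreal h"
    using h by (simp add: ennreal_mult mult_ac)
  also have "\<dots> \<le> (\<integral>\<^sup>+r\<in>{norm w - h..norm w}. ennreal ((1 - r) powr (- \<kappa> - 1)) \<partial>lborel) * ennreal h"
    unfolding d_def using assms h
    by (intro mult_right_mono nn_integral_interval_powr_ge) (auto simp: d_def)
  also have "\<dots> = (\<integral>\<^sup>+t. (\<integral>\<^sup>+r\<in>{norm w - h..norm w}. ennreal ((1 - r) powr (- \<kappa> - 1)) \<partial>lborel) * indicator {l..l + h} t \<partial>lborel)"
    using h by (subst nn_integral_cmult_indicator) auto
  also have "\<dots> = (\<integral>\<^sup>+t. \<integral>\<^sup>+r. ennreal ((1 - r) powr (- \<kappa> - 1)) * indicator (polar_box \<epsilon> w) (r, t) \<partial>lborel \<partial>lborel)"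
    by (subst nn_integral_multc[symmetric]) (auto simp: box indicator_times mult.assoc)
  finally show ?thesis by (simp add: d_def)
qed

lemma pseudohyperbolic_dist_le_of_close:
  assumes "norm w < 1" "norm z \<le> 1" "norm (z - w) \<le> c * (1 - norm w)"
  shows "pseudohyperbolic_dist z w \<le> c"
proof -
  have "norm (z - w) \<le> c * norm (1 - cnj w * z)"
  proof -
    have "0 \<le> c * (1 - norm w)" using assms(3) norm_ge_zero order_trans by blast
    then have "0 \<le> c" using assms(1) by (simp add: zero_le_mult_iff)
    then have "c * (1 - norm w) \<le> c * norm (1 - cnj w * z)"
      by (intro mult_left_mono blaschke_denominator_bound' assms)
    then show ?thesis using assms(3) by linarith
  qed
  moreover have "1 - cnj w * z \<noteq> 0"
    using blaschke_denominator_nonzero assms by auto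
  ultimately show ?thesis
    by (simp add: pseudohyperbolic_dist_def norm_divide divide_le_eq)
qed

lemma pseudohyperbolic_dist_commute: "pseudohyperbolic_dist z w = pseudohyperbolic_dist w z"
proof -
  have "norm (1 - cnj w * z) = norm (cnj (1 - cnj w * z))" by (rule complex_mod_cnj[symmetric])
  also have "\<dots> = norm (1 - cnj z * w)" by (simp add: mult.commute)
  finally show ?thesis
    by (simp only: pseudohyperbolic_dist_def norm_divide norm_minus_commute[of z w])
qed

text \<open>
  A common point would be within \<open>2 \<epsilon> (1 - |v|)\<close> of \<open>v\<close> and within
  \<open>2 \<epsilon> (1 - |w|)\<close> of \<open>w\<close>.  Measured against the larger of the two distances to the
  boundary, this puts \<open>v\<close> and \<open>w\<close> at pseudohyperbolic distance at most \<open>4 \<epsilon>\<close>.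
\<close>

lemma polar_boxes_disjoint:
  assumes sep: "\<delta> \<le> pseudohyperbolic_dist v w" and \<epsilon>: "0 \<le> \<epsilon>" "\<epsilon> \<le> 1/4" "4 * \<epsilon> < \<delta>"
    and v: "3/4 \<le> norm v" "norm v < 1" and w: "3/4 \<le> norm w" "norm w < 1"
  shows "polar_box \<epsilon> v \<inter> polar_box \<epsilon> w = {}"
proof -
  have *: False
    if rt: "(r, t) \<in> polar_box \<epsilon> v" "(r, t) \<in> polar_box \<epsilon> w" and sep: "\<delta> \<le> pseudohyperbolic_dist v w"
      and v: "3/4 \<le> norm v" "norm v < 1" and w: "3/4 \<le> norm w" "norm w < 1" and le: "norm w \<le> norm v"
    for r t v w
  proof -
    let ?z = "of_real r * cis t"
    have "norm (v - w) \<le> norm (?z - v) + norm (?z - w)"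
      by (metis add.commute dist_norm dist_triangle norm_minus_commute)
    also have "\<dots> \<le> 2 * \<epsilon> * (1 - norm v) + 2 * \<epsilon> * (1 - norm w)"
      by (intro add_mono polar_box_properties(5)[OF \<epsilon>(1,2)] v w rt)
    also have "\<dots> \<le> 2 * \<epsilon> * (1 - norm w) + 2 * \<epsilon> * (1 - norm w)"
      using le \<epsilon> by (intro add_mono mult_left_mono) auto
    finally have "pseudohyperbolic_dist v w \<le> 4 * \<epsilon>"
      by (intro pseudohyperbolic_dist_le_of_close) (use v w in auto)
    then show False using sep \<epsilon> by linarith
  qed
  show ?thesis
  proof (cases "norm w \<le> norm v")
    case True
    then show ?thesis using *[of _ _ v w] sep v w by auto
  next
    case False
    then show ?thesis using *[of _ _ w v] sep v w by (auto simp: pseudohyperbolic_dist_commute)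
  qed
qed

lemma bergman_space_weighted_integral_finite:
  assumes "f \<in> bergman_space p \<alpha>"
  shows "(\<integral>\<^sup>+z\<in>ball 0 1. ennreal (norm (f z) powr p * (1 - norm z) powr \<alpha>) \<partial>lborel) < \<infinity>"
proof -
  let ?I = "\<integral>\<^sup>+z\<in>ball 0 1. ennreal (norm (f z) powr p * (1 - norm z) powr \<alpha>) \<partial>lborel"
  have "ennreal (1 / pi) * ?I \<noteq> \<infinity>"
    using assms by (auto simp: bergman_space_def bergman_norm_def ennreal_powr_def)
  then have "?I \<noteq> \<infinity>"
    by (auto simp: ennreal_mult_eq_top_iff)
  then show ?thesis by (simp add: less_top)
qed

text \<open>
  The boxes at the zeros are disjoint and \<open>|B| \<le> 2 \<epsilon> \<le> 1/2\<close> on them, so \<open>disc_hardy_inequality\<close> applies to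
  their union.  A finite set of zeros keeps this union away from the boundary; the bound does not depend on
  that set.
\<close>

lemma blaschke_zero_sum_bound:
  assumes bl: "blaschke_sequence a" and sep: "\<And>m n. m \<noteq> n \<Longrightarrow> \<delta> \<le> pseudohyperbolic_dist (a m) (a n)"
    and \<epsilon>: "0 < \<epsilon>" "\<epsilon> \<le> 1/4" "4 * \<epsilon> < \<delta>" and \<kappa>: "0 < \<kappa>" "\<kappa> < p"
    and F: "finite F" "\<And>n. n \<in> F \<Longrightarrow> 3/4 \<le> norm (a n)"
  shows "ennreal (\<Sum>n\<in>F. \<epsilon>\<^sup>2 * 2 powr (- \<kappa> - 1) * (1 - norm (a n)) powr (1 - \<kappa>))
    \<le> ennreal (80 * hardy_const p \<kappa> / \<kappa>) *
      (\<integral>\<^sup>+z\<in>ball 0 1. ennreal (norm (deriv (blaschke_product a) z) powr p * (1 - norm z) powr (p - 1 - \<kappa>)) \<partial>lborel)"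
proof -
  note nrm = zero_norms[OF bl]
  define E where "E = (\<Union>n\<in>F. polar_box \<epsilon> (a n))"
  define r0 where "r0 = Max (insert 0 ((\<lambda>n. norm (a n)) ` F))"
  have r0: "r0 < 1" "\<And>n. n \<in> F \<Longrightarrow> norm (a n) \<le> r0"
    using F nrm by (auto simp: r0_def)
  have closed_box: "closed (polar_box \<epsilon> w)" for w
    by (auto simp: polar_box_def Let_def intro!: closed_Times)
  have [measurable]: "polar_box \<epsilon> w \<in> sets borel" for w
    by (intro borel_closed closed_box)
  have disj: "disjoint_family_on (\<lambda>n. polar_box \<epsilon> (a n)) F"
    unfolding disjoint_family_on_def
    by (intro ballI impI polar_boxes_disjoint[OF sep]) (use \<epsilon> F nrm in auto)
  have ind: "indicator E x = (\<Sum>n\<in>F. indicator (polar_box \<epsilon> (a n)) x :: ennreal)" for x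
    unfolding E_def by (rule indicator_UN_disjoint[OF F(1) disj])
  have "ennreal (\<Sum>n\<in>F. \<epsilon>\<^sup>2 * 2 powr (- \<kappa> - 1) * (1 - norm (a n)) powr (1 - \<kappa>))
      = (\<Sum>n\<in>F. ennreal (\<epsilon>\<^sup>2 * 2 powr (- \<kappa> - 1) * (1 - norm (a n)) powr (1 - \<kappa>)))"
    by (rule sum_ennreal[symmetric]) simp
  also have "\<dots> \<le> (\<Sum>n\<in>F. \<integral>\<^sup>+t. \<integral>\<^sup>+r. ennreal ((1 - r) powr (- \<kappa> - 1)) * indicator (polar_box \<epsilon> (a n)) (r, t) \<partial>lborel \<partial>lborel)"
    by (intro sum_mono polar_box_weight_ge) (use \<epsilon> \<kappa> nrm in auto)
  also have "\<dots> = (\<integral>\<^sup>+t. \<integral>\<^sup>+r. (\<Sum>n\<in>F. ennreal ((1 - r) powr (- \<kappa> - 1)) * indicator (polar_box \<epsilon> (a n)) (r, t)) \<partial>lborel \<partial>lborel)"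
    by (simp add: nn_integral_sum)
  also have "\<dots> = (\<integral>\<^sup>+t. \<integral>\<^sup>+r. ennreal ((1 - r) powr (- \<kappa> - 1)) * indicator E (r, t) \<partial>lborel \<partial>lborel)"
    by (simp add: ind sum_distrib_left)
  also have "\<dots> \<le> ennreal (80 * hardy_const p \<kappa> / \<kappa>) *
      (\<integral>\<^sup>+z\<in>ball 0 1. ennreal (norm (deriv (blaschke_product a) z) powr p * (1 - norm z) powr (p - 1 - \<kappa>)) \<partial>lborel)"
  proof (rule disc_hardy_inequality)
    show "\<exists>R>\<rho>. 0 < R \<and> R < 1 \<and> integral {0..2 * pi} (\<lambda>t. 1 - norm (blaschke_product a (of_real R * cis t))) \<le> e"
      if "0 < e" "\<rho> < 1" for e \<rho> :: real
      using blaschke_defect_circle_mean_small[OF bl that] by metis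
    show "E \<in> sets borel"
      unfolding E_def using F(1) by measurable
    show "E \<subseteq> {1/2..r0} \<times> {0..2 * pi}"
    proof (rule subrelI)
      fix r t assume "(r, t) \<in> E"
      then obtain n where n: "n \<in> F" "(r, t) \<in> polar_box \<epsilon> (a n)" by (auto simp: E_def)
      then show "(r, t) \<in> {1/2..r0} \<times> {0..2 * pi}"
        using polar_box_properties[of \<epsilon> "a n" r t] \<epsilon> F(2)[of n] nrm[of n] r0(2)[of n] by auto
    qed
    fix r t assume "(r, t) \<in> E"
    then obtain n where n: "n \<in> F" "(r, t) \<in> polar_box \<epsilon> (a n)" by (auto simp: E_def)
    note box = polar_box_properties[OF less_imp_le[OF \<epsilon>(1)] \<epsilon>(2) F(2)[OF n(1)] nrm(2) n(2)]
    have z: "norm (of_real r * cis t) < 1"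
      using box nrm(2)[of n] by (simp add: norm_mult)
    have "norm (blaschke_product a (of_real r * cis t)) \<le> pseudohyperbolic_dist (of_real r * cis t) (a n)"
      by (rule norm_blaschke_product_le_pseudohyperbolic[OF bl z])
    also have "\<dots> \<le> 2 * \<epsilon>"
      by (rule pseudohyperbolic_dist_le_of_close) (use nrm z box in auto)
    finally show "norm (blaschke_product a (of_real r * cis t)) \<le> 1/2" using \<epsilon> by linarith
  qed (use bl \<kappa> r0 in \<open>auto intro: holomorphic_blaschke_product norm_blaschke_product_le_1\<close>)
  finally show ?thesis .
qed

theorem theorem1:
  fixes a :: "nat \<Rightarrow> complex" and p \<alpha> :: real
  assumes "blaschke_sequence a"
    and "uniformly_discrete a"
    and "\<alpha> > -1"
    and "\<alpha> + 1 < p" and "p < \<alpha> + 2"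
    and "deriv (blaschke_product a) \<in> bergman_space p \<alpha>"
  shows "summable (\<lambda>n. (1 - norm (a n)) powr (2 - p + \<alpha>))"
proof -
  define \<kappa> where "\<kappa> = p - 1 - \<alpha>"
  have \<kappa>: "0 < \<kappa>" "\<kappa> < p" and \<alpha>: "\<alpha> = p - 1 - \<kappa>" "2 - p + \<alpha> = 1 - \<kappa>"
    using assms(3-5) by (auto simp: \<kappa>_def)
  obtain \<delta> where \<delta>: "0 < \<delta>" "\<And>m n. m \<noteq> n \<Longrightarrow> \<delta> \<le> pseudohyperbolic_dist (a m) (a n)"
    using assms(2) by (auto simp: uniformly_discrete_def)
  \<comment> \<open>The bound 1/4 gives \<open>|B| \<le> 1/2\<close> on the boxes, the bound \<open>\<delta> / 8\<close> makes them disjoint.\<close>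
  define \<epsilon> where "\<epsilon> = min (1/4) (\<delta> / 8)"
  have \<epsilon>: "0 < \<epsilon>" "\<epsilon> \<le> 1/4" "4 * \<epsilon> < \<delta>" using \<delta>(1) by (auto simp: \<epsilon>_def)
  define c where "c = \<epsilon>\<^sup>2 * 2 powr (- \<kappa> - 1)"
  have c: "0 < c" using \<epsilon> by (simp add: c_def)
  let ?T = "ennreal (80 * hardy_const p \<kappa> / \<kappa>) *
      (\<integral>\<^sup>+z\<in>ball 0 1. ennreal (norm (deriv (blaschke_product a) z) powr p * (1 - norm z) powr (p - 1 - \<kappa>)) \<partial>lborel)"
  have "?T < top"
    using bergman_space_weighted_integral_finite[OF assms(6)] unfolding \<alpha>(1)
    by (simp add: ennreal_mult_less_top)
  then obtain M where M: "0 \<le> M" "?T = ennreal M"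
    by (cases "?T" rule: ennreal_cases) auto
  have "summable (\<lambda>n. 1 - norm (a n))"
    using assms(1) by (simp add: blaschke_sequence_def)
  then have "eventually (\<lambda>n. 1 - norm (a n) < 1/4) sequentially"
    by (intro order_tendstoD(2)[OF summable_LIMSEQ_zero]) auto
  \<comment> \<open>Only finitely many zeros are so close to 0 that their boxes may leave \<open>r \<ge> 1/2\<close>.\<close>
  then obtain N where N: "\<And>n. n \<ge> N \<Longrightarrow> 3/4 \<le> norm (a n)"
    unfolding eventually_sequentially by force
  have "summable (\<lambda>n. (1 - norm (a (n + N))) powr (1 - \<kappa>))"
  proof (rule summableI_nonneg_bounded)
    fix k
    have "ennreal (\<Sum>n=N..<k + N. c * (1 - norm (a n)) powr (1 - \<kappa>)) \<le> ennreal M"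
      unfolding M(2)[symmetric] c_def
      by (rule blaschke_zero_sum_bound[OF assms(1) \<delta>(2) \<epsilon> \<kappa>]) (use N in auto)
    then have "(\<Sum>n=N..<k + N. c * (1 - norm (a n)) powr (1 - \<kappa>)) \<le> M"
      using M(1) by (simp only: ennreal_le_iff)
    then have "c * (\<Sum>n=N..<k + N. (1 - norm (a n)) powr (1 - \<kappa>)) \<le> M"
      by (simp add: sum_distrib_left)
    then have "(\<Sum>n=N..<k + N. (1 - norm (a n)) powr (1 - \<kappa>)) \<le> M / c"
      using c by (simp add: field_simps)
    moreover have "(\<Sum>n=N..<k + N. (1 - norm (a n)) powr (1 - \<kappa>)) = (\<Sum>n<k. (1 - norm (a (n + N))) powr (1 - \<kappa>))"
      using sum.shift_bounds_nat_ivl[of "\<lambda>n. (1 - norm (a n)) powr (1 - \<kappa>)" 0 N k]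
      by (simp add: lessThan_atLeast0)
    ultimately show "(\<Sum>n<k. (1 - norm (a (n + N))) powr (1 - \<kappa>)) \<le> M / c" by simp
  qed simp
  then show ?thesis
    unfolding \<alpha>(2) by (rule summable_iff_shift[THEN iffD1])
qed

end
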